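(* Let $\Lambda\subseteq\mathbb{R}^d$ be a $d$-dimensional lattice and $F,G\colon K\to\mathbb{R}$ two $\Lambda$-periodic filters on a $\Lambda$-periodic cell complex $K$. Then $d_I(\mathcal{M}(F,\Lambda),\mathcal{M}(G,\Lambda))\le\|F-G\|_\infty$, and hence $J([\mathcal{M}(F,\Lambda)],[\mathcal{M}(G,\Lambda)])\le\|F-G\|_\infty$, where $\|F-G\|_\infty=\sup_{\sigma\in K}|F(\sigma)-G(\sigma)|$.
   Context: A cell complex $K$ in $\mathbb{R}^d$ is a locally finite collection of cells (each homeomorphic to a closed ball, boundaries unions of lower-dimensional cells, intersections unions of shared faces). A lattice spanned by linearly independent $u_1,\dots,u_p\in\mathbb{R}^d$ is the set of their integer combinations, of dimension $p$; $\mathrm{vol}_p$ denotes the $p$-dimensional volume of its unit cell $\{\sum c_iu_i: c_i\in[0,1)\}$ ($\mathrm{vol}_0(\{0\})=1$). $K$ is $\Lambda$-periodic if $\sigma+u\in K$ for $\sigma\in K,u\in\Lambda$; a filter $F\colon K\to\mathbb{R}$ satisfies $F(\sigma)\le F(\tau)$ when $\sigma$ is a face of $\tau$, and is $\Lambda$-periodic if $F(\sigma+u)=F(\sigma)$. $K/\Lambda$ is the finite quotient complex on the torus $\mathbb{R}^d/\Lambda$ and $F/\Lambda$ the quotient filter. The merge tree of a filter on a complex $L$ is the quotient of $\{(x,s): x\in L_s\}$ ($L_s$ the sublevel set at $s$) by $(x,s)\sim(y,t)$ iff $s=t$ and $x,y$ lie in the same component of $L_s$, with quotient topology and height $h$ (the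 $s$-coordinate); points are identified with components of sublevel sets; $B$ covers $A$ if $h(A)\le h(B)$ and $A\subseteq B$. For a component $\Gamma$ of $(K/\Lambda)_t$, with $\phi\colon\mathbb{R}^d\to\mathbb{R}^d/\Lambda$ the projection, a shadow is a component of $\phi^{-1}(\Gamma)$ and the periodicity lattice is $\Lambda_\Gamma=\{u\in\Lambda:\gamma+u=\gamma\}$ for a shadow $\gamma$; with $p=\dim\Lambda_\Gamma$ and $\nu_q$ the volume of the unit $q$-ball, the shadow monomial is $\frac{\mathrm{vol}_p(\Lambda_\Gamma)}{\mathrm{vol}_d(\Lambda)}\nu_{d-p}R^{d-p}$. The periodic merge tree $\mathcal{M}(F,\Lambda)$ is the merge tree of $F/\Lambda$ with height $h$ and frequency function $\Phi$ assigning each point its shadow monomial. Monomials are ordered by $tR^a<sR^b$ iff $a<b$, or $a=b$ and $t<s$. Interleaving distance: continuous maps $\varphi\colon\mathcal{M}\to\mathcal{M}'$, $\psi\colon\mathcal{M}'\to\mathcal{M}$ between periodic merge trees (heights $h,h'$, frequencies $\Phi,\Phi'$) are $\varepsilon$-compatible if for all $\Gamma\in\mathcal{M}$, $\Gamma'\in\mathcal{M}'$: (i) $h'(\varphi(\Gamma))=h(\Gamma)+\varepsilon$, $h(\psi(\Gamma'))=h'(\Gamma')+\varepsilon$; (ii) $\psi(\varphi(\Gamma))$ covers $\Gamma$ and $\varphi(\psi(\Gamma'))$ covers $\Gamma'$; (iii) $\Phi'(\varphi(\Gamma))\le\Phi(\Gamma)$, $\Phi(\psi(\Gamma'))\le\Phi'(\Gamma')$.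 $d_I(\mathcal{M},\mathcal{M}')$ is the infimum of such $\varepsilon\ge0$. Splintering: $\mathcal{M}_\Gamma$ is the subtree of points covered by $\Gamma$. $\mathcal{M}'$ splinters $\mathcal{M}$ if there is a continuous surjection $\omega\colon\mathcal{M}'\to\mathcal{M}$ with $h\circ\omega=h'$ such that for every $\Gamma\in\mathcal{M}$ and all $A,B\in\omega^{-1}(\Gamma)$: $d_I(\mathcal{M}'_A,\mathcal{M}'_B)=0$, $\omega$ maps each of $\mathcal{M}'_A,\mathcal{M}'_B$ onto $\mathcal{M}_\Gamma$, and $\Phi'(A)=\Phi'(B)=\Phi(\Gamma)/|\omega^{-1}(\Gamma)|$. $\mathcal{M}\simeq\mathcal{N}$ if some periodic merge tree splinters both; $[\mathcal{M}]$ is the class. $J([\mathcal{M}],[\mathcal{M}'])=\inf\sum_{i=1}^k d_I(\mathcal{M}_i,\mathcal{M}_i')$ over finite sequences with $\mathcal{M}_1\in[\mathcal{M}]$, $\mathcal{M}_k'\in[\mathcal{M}']$, $\mathcal{M}_i'\simeq\mathcal{M}_{i+1}$. *)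

theory Defs
  imports "HOL-Analysis.Analysis"
begin

definition qtop :: "'a topology \<Rightarrow> ('a \<Rightarrow> 'b) \<Rightarrow> 'b topology" where
  "qtop X f = topology (\<lambda>U. U \<subseteq> f ` topspace X \<and> openin X {x \<in> topspace X. f x \<in> U})"

lemma istopology_qtop:
  "istopology (\<lambda>U. U \<subseteq> f ` topspace X \<and> openin X {x \<in> topspace X. f x \<in> U})"
proof -
  have i: "openin X {x \<in> topspace X. f x \<in> S \<inter> T}"
    if "openin X {x \<in> topspace X. f x \<in> S}" "openin X {x \<in> topspace X. f x \<in> T}" for S T
  proof -
    have "{x \<in> topspace X. f x \<in> S \<inter> T} =
       {x \<in> topspace X. f x \<in> S} \<inter> {x \<in> topspace X. f x \<in> T}" by auto
    then show ?thesis using that by auto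
  qed
  have u: "openin X {x \<in> topspace X. f x \<in> \<Union>\<K>}"
    if "\<forall>U\<in>\<K>. openin X {x \<in> topspace X. f x \<in> U}" for \<K>
  proof -
    have "{x \<in> topspace X. f x \<in> \<Union>\<K>} = \<Union>((\<lambda>U. {x \<in> topspace X. f x \<in> U}) ` \<K>)"
      by auto
    moreover have "openin X (\<Union>((\<lambda>U. {x \<in> topspace X. f x \<in> U}) ` \<K>))"
      using that by (intro openin_Union) auto
    ultimately show ?thesis by simp
  qed
  show ?thesis unfolding istopology_def
    using i u by blast
qed

lemma openin_qtop:
  "openin (qtop X f) U \<longleftrightarrow> U \<subseteq> f ` topspace X \<and> openin X {x \<in> topspace X. f x \<in> U}"
  unfolding qtop_def using istopology_qtop[of f X] by (simp add: topology_inverse')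

definition cdim :: "'a::euclidean_space set \<Rightarrow> nat" where
  "cdim \<sigma> = (THE k. \<exists>S::'a set. subspace S \<and> dim S = k \<and> \<sigma> homeomorphic (cball 0 1 \<inter> S))"

definition cell_complex :: "'a::euclidean_space set set \<Rightarrow> bool" where
  "cell_complex K \<longleftrightarrow>
     \<comment> \<open>each cell is homeomorphic to a closed ball; its boundary (image of the sphere)
        is a union of lower-dimensional cells of K\<close>
     (\<forall>\<sigma>\<in>K. \<exists>(S::'a set) h h'. subspace S \<and> homeomorphism (cball 0 1 \<inter> S) \<sigma> h h' \<and>
          (\<exists>T\<subseteq>K. (\<forall>\<tau>\<in>T. cdim \<tau> < dim S) \<and> h ` (sphere 0 1 \<inter> S) = \<Union>T)) \<and>
     \<comment> \<open>intersections are unions of shared faces\<close>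
     (\<forall>\<sigma>\<in>K. \<forall>\<tau>\<in>K. \<sigma> \<inter> \<tau> = \<Union>{\<rho>\<in>K. \<rho> \<subseteq> \<sigma> \<and> \<rho> \<subseteq> \<tau>}) \<and>
     \<comment> \<open>local finiteness\<close>
     (\<forall>x. \<exists>e>0. finite {\<sigma>\<in>K. \<sigma> \<inter> ball x e \<noteq> {}})"

text \<open>Faces: \<open>\<sigma>\<close> is a face of \<open>\<tau>\<close> iff \<open>\<sigma> \<subseteq> \<tau>\<close> (both cells of K).\<close>

definition filter_on :: "'a::euclidean_space set set \<Rightarrow> ('a set \<Rightarrow> real) \<Rightarrow> bool" where
  "filter_on K F \<longleftrightarrow> (\<forall>\<sigma>\<in>K. \<forall>\<tau>\<in>K. \<sigma> \<subseteq> \<tau> \<longrightarrow> F \<sigma> \<le> F \<tau>)"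

definition int_span :: "'a::euclidean_space set \<Rightarrow> 'a set" where
  "int_span U = {\<Sum>u\<in>U. of_int (c u) *\<^sub>R u | c. True}"

definition is_lattice :: "'a::euclidean_space set \<Rightarrow> bool" where
  "is_lattice L \<longleftrightarrow> (\<exists>U. finite U \<and> independent U \<and> L = int_span U)"

text \<open>Dimension of a lattice: number of generators = dimension of its span.\<close>

definition lattice_dim :: "'a::euclidean_space set \<Rightarrow> nat" where
  "lattice_dim L = dim L"

definition unit_cell :: "'a::euclidean_space set \<Rightarrow> 'a set" where
  "unit_cell U = {\<Sum>u\<in>U. c u *\<^sub>R u | c. \<forall>u\<in>U. 0 \<le> c u \<and> c u < 1}"

text \<open>p-dimensional volume of a set lying in a p-dimensional subspace V: Lebesgue measure
  on R^p of its image under the coordinate map w.r.t. an orthonormal basis b_0..b_(p-1) of V.\<close>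

definition pvol :: "nat \<Rightarrow> 'a::euclidean_space set \<Rightarrow> 'a set \<Rightarrow> real" where
  "pvol p V A = (let b = (SOME b :: nat \<Rightarrow> 'a. (\<forall>i<p. \<forall>j<p. b i \<bullet> b j = (if i = j then 1 else 0))
                                            \<and> span (b ` {..<p}) = V)
                 in measure (PiM {..<p} (\<lambda>_. lborel :: real measure)) ((\<lambda>x. \<lambda>i\<in>{..<p}. x \<bullet> b i) ` A))"

definition lattice_vol :: "'a::euclidean_space set \<Rightarrow> real" where
  "lattice_vol L = (let U = (SOME U. finite U \<and> independent U \<and> L = int_span U)
                    in pvol (card U) (span U) (unit_cell U))"

definition periodic_complex :: "'a::euclidean_space set set \<Rightarrow> 'a set \<Rightarrow> bool" where
  "periodic_complex K L \<longleftrightarrow> (\<forall>\<sigma>\<in>K. \<forall>u\<in>L. (\<lambda>x. x + u) ` \<sigma> \<in> K)"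

definition periodic_filter :: "'a::euclidean_space set set \<Rightarrow> 'a set \<Rightarrow> ('a set \<Rightarrow> real) \<Rightarrow> bool" where
  "periodic_filter K L F \<longleftrightarrow> filter_on K F \<and> (\<forall>\<sigma>\<in>K. \<forall>u\<in>L. F ((\<lambda>x. x + u) ` \<sigma>) = F \<sigma>)"

text \<open>Points of the torus R^d/L are the cosets x + L; \<open>tproj L\<close> is the projection \<open>\<phi>\<close>.\<close>

definition tproj :: "'a::euclidean_space set \<Rightarrow> 'a \<Rightarrow> 'a set" where
  "tproj L x = {x + u | u. u \<in> L}"

definition torus_top :: "'a::euclidean_space set \<Rightarrow> 'a set topology" where
  "torus_top L = qtop euclidean (tproj L)"

text \<open>Sublevel set at s of the quotient filter F/L on K/L (cells of K/L are the images
  \<open>\<phi>(\<sigma>)\<close>, with (F/L)(\<phi>(\<sigma>)) = F(\<sigma>)).\<close>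

definition tsub :: "'a::euclidean_space set set \<Rightarrow> ('a set \<Rightarrow> real) \<Rightarrow> 'a set \<Rightarrow> real \<Rightarrow> 'a set set" where
  "tsub K F L s = \<Union>{tproj L ` \<sigma> | \<sigma>. \<sigma> \<in> K \<and> F \<sigma> \<le> s}"

definition mt_pt :: "'b topology \<Rightarrow> (real \<Rightarrow> 'b set) \<Rightarrow> 'b \<times> real \<Rightarrow> 'b set \<times> real" where
  "mt_pt T Sub = (\<lambda>(x, s). (connected_component_of_set (subtopology T (Sub s)) x, s))"

definition mt_top :: "'b topology \<Rightarrow> (real \<Rightarrow> 'b set) \<Rightarrow> ('b set \<times> real) topology" where
  "mt_top T Sub = qtop (subtopology (prod_topology T euclideanreal) {(x, s). x \<in> Sub s}) (mt_pt T Sub)"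

text \<open>Monomials t R^a are represented as pairs (a, t).\<close>

type_synonym monomial = "nat \<times> real"

definition mono_le :: "monomial \<Rightarrow> monomial \<Rightarrow> bool" where
  "mono_le m n \<longleftrightarrow> fst m < fst n \<or> (fst m = fst n \<and> snd m \<le> snd n)"

record 'p mtree =
  mtop :: "'p topology"
  hgt :: "'p \<Rightarrow> real"
  frq :: "'p \<Rightarrow> monomial"

type_synonym 'a pmtree = "('a set set \<times> real) mtree"

definition shadow :: "'a::euclidean_space set \<Rightarrow> 'a set set \<Rightarrow> 'a set" where
  "shadow L \<Gamma> = (SOME \<gamma>. \<gamma> \<in> components {y. tproj L y \<in> \<Gamma>})"

definition period_lattice :: "'a::euclidean_space set \<Rightarrow> 'a set set \<Rightarrow> 'a set" where
  "period_lattice L \<Gamma> = {u \<in> L. (\<lambda>y. y + u) ` shadow L \<Gamma> = shadow L \<Gamma>}"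

definition shadow_monomial :: "'a::euclidean_space set \<Rightarrow> 'a set set \<Rightarrow> monomial" where
  "shadow_monomial L \<Gamma> =
     (let P = period_lattice L \<Gamma>; p = lattice_dim P
      in (DIM('a) - p, lattice_vol P / lattice_vol L * unit_ball_vol (real (DIM('a) - p))))"

definition pmt :: "'a::euclidean_space set set \<Rightarrow> ('a set \<Rightarrow> real) \<Rightarrow> 'a set \<Rightarrow> 'a pmtree" where
  "pmt K F L = \<lparr> mtop = mt_top (torus_top L) (tsub K F L), hgt = snd,
                 frq = (\<lambda>\<Gamma>. shadow_monomial L (fst \<Gamma>)) \<rparr>"

definition covers :: "'a pmtree \<Rightarrow> 'a set set \<times> real \<Rightarrow> 'a set set \<times> real \<Rightarrow> bool" where
  "covers M B A \<longleftrightarrow> hgt M A \<le> hgt M B \<and> fst A \<subseteq> fst B"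

definition compatible :: "real \<Rightarrow> 'a pmtree \<Rightarrow> 'a pmtree \<Rightarrow>
     ('a set set \<times> real \<Rightarrow> 'a set set \<times> real) \<Rightarrow> ('a set set \<times> real \<Rightarrow> 'a set set \<times> real) \<Rightarrow> bool" where
  "compatible \<epsilon> M M' \<phi> \<psi> \<longleftrightarrow>
     continuous_map (mtop M) (mtop M') \<phi> \<and> continuous_map (mtop M') (mtop M) \<psi> \<and>
     (\<forall>\<Gamma>\<in>topspace (mtop M). hgt M' (\<phi> \<Gamma>) = hgt M \<Gamma> + \<epsilon> \<and> covers M (\<psi> (\<phi> \<Gamma>)) \<Gamma> \<and>
                                mono_le (frq M' (\<phi> \<Gamma>)) (frq M \<Gamma>)) \<and>
     (\<forall>\<Gamma>'\<in>topspace (mtop M'). hgt M (\<psi> \<Gamma>') = hgt M' \<Gamma>' + \<epsilon> \<and> covers M' (\<phi> (\<psi> \<Gamma>')) \<Gamma>' \<and>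
                                mono_le (frq M (\<psi> \<Gamma>')) (frq M' \<Gamma>'))"

definition dI :: "'a pmtree \<Rightarrow> 'a pmtree \<Rightarrow> ereal" where
  "dI M M' = Inf {ereal \<epsilon> | \<epsilon>. \<epsilon> \<ge> 0 \<and> (\<exists>\<phi> \<psi>. compatible \<epsilon> M M' \<phi> \<psi>)}"

definition subtree :: "'a pmtree \<Rightarrow> 'a set set \<times> real \<Rightarrow> 'a pmtree" where
  "subtree M \<Gamma> = M\<lparr> mtop := subtopology (mtop M) {A \<in> topspace (mtop M). covers M \<Gamma> A} \<rparr>"

definition splinters :: "'a pmtree \<Rightarrow> 'a pmtree \<Rightarrow> bool" where
  "splinters M' M \<longleftrightarrow> (\<exists>\<omega>. continuous_map (mtop M') (mtop M) \<omega> \<and>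
      \<omega> ` topspace (mtop M') = topspace (mtop M) \<and>
      (\<forall>x\<in>topspace (mtop M'). hgt M (\<omega> x) = hgt M' x) \<and>
      (\<forall>\<Gamma>\<in>topspace (mtop M).
         let Fib = {A \<in> topspace (mtop M'). \<omega> A = \<Gamma>} in
         finite Fib \<and>
         (\<forall>A\<in>Fib. \<forall>B\<in>Fib. dI (subtree M' A) (subtree M' B) = 0 \<and>
             \<omega> ` topspace (mtop (subtree M' A)) = topspace (mtop (subtree M \<Gamma>)) \<and>
             \<omega> ` topspace (mtop (subtree M' B)) = topspace (mtop (subtree M \<Gamma>)) \<and>
             frq M' A = (fst (frq M \<Gamma>), snd (frq M \<Gamma>) / real (card Fib)) \<and>
             frq M' B = (fst (frq M \<Gamma>), snd (frq M \<Gamma>) / real (card Fib)))))"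

definition admissible :: "'a::euclidean_space set set \<Rightarrow> ('a set \<Rightarrow> real) \<Rightarrow> 'a set \<Rightarrow> bool" where
  "admissible K F L \<longleftrightarrow> is_lattice L \<and> lattice_dim L = DIM('a) \<and> cell_complex K \<and>
                         periodic_complex K L \<and> periodic_filter K L F"

definition pmtrees :: "'a::euclidean_space pmtree set" where
  "pmtrees = {pmt K F L | K F L. admissible K F L}"

definition pmt_equiv :: "'a::euclidean_space pmtree \<Rightarrow> 'a pmtree \<Rightarrow> bool" where
  "pmt_equiv M N \<longleftrightarrow> M \<in> pmtrees \<and> N \<in> pmtrees \<and> (\<exists>P\<in>pmtrees. splinters P M \<and> splinters P N)"

text \<open>J([M],[M']) (depends only on the classes; stated on representatives).\<close>

definition J_dist :: "'a::euclidean_space pmtree \<Rightarrow> 'a pmtree \<Rightarrow> ereal" where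
  "J_dist M M' = Inf {(\<Sum>i<k. dI (Ms i) (Ms' i)) | k (Ms :: nat \<Rightarrow> 'a pmtree) (Ms' :: nat \<Rightarrow> 'a pmtree). k \<ge> 1 \<and>
       (\<forall>i<k. Ms i \<in> pmtrees \<and> Ms' i \<in> pmtrees) \<and>
       pmt_equiv M (Ms 0) \<and> pmt_equiv M' (Ms' (k - 1)) \<and>
       (\<forall>i. i + 1 < k \<longrightarrow> pmt_equiv (Ms' i) (Ms (i + 1)))}"

text \<open>Sup norm over K (with the convention that it is 0 for empty K).\<close>

definition sup_dist :: "'a set set \<Rightarrow> ('a set \<Rightarrow> real) \<Rightarrow> ('a set \<Rightarrow> real) \<Rightarrow> ereal" where
  "sup_dist K F G = Sup (insert 0 ((\<lambda>\<sigma>. ereal \<bar>F \<sigma> - G \<sigma>\<bar>) ` K))"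

end

theory Submission
  imports Defs
begin

text \<open>
  Let \<open>\<epsilon>\<close> be the sup distance of the filters. The sublevel set of \<open>F\<close> at \<open>s\<close> lies in that of \<open>G\<close> at
  \<open>s + \<epsilon>\<close> and vice versa, so sending a component to the component containing it \<open>\<epsilon>\<close> higher up in the other
  filtration gives a pair of continuous maps satisfying the height and covering conditions.

  For the frequencies let \<open>A \<subseteq> B\<close> be such components. Sublevel sets are locally finite unions of closed
  connected cells, so the lattice permutes the shadows of a component transitively; the periodicity lattice
  thus does not depend on the shadow, and \<open>\<Lambda>\<^sub>A \<subseteq> \<Lambda>\<^sub>B\<close>. If the dimensions differ, the exponent of
  the shadow monomial drops. If they agree, a unit cell of \<open>\<Lambda>\<^sub>B\<close> can be cut into pieces
  which are moved by \<open>\<Lambda>\<^sub>A\<close> to disjoint subsets of a unit cell of \<open>\<Lambda>\<^sub>A\<close>, so the volume does not increase.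

  The bound on \<open>J\<close> follows since every tree splinters itself.
\<close>

section \<open>Subgroups of lattices\<close>

lemma int_span_memI: "(\<Sum>u\<in>U. of_int (c u) *\<^sub>R u) \<in> int_span U"
  unfolding int_span_def by blast

lemma int_span_superset: assumes "finite U" shows "U \<subseteq> int_span U"
proof
  fix v assume "v \<in> U"
  then have "(\<Sum>u\<in>U. of_int (if u = v then 1 else 0) *\<^sub>R u) = v"
    using assms by (simp add: if_distrib[of real_of_int] if_distrib[of "\<lambda>c. c *\<^sub>R _"] sum.delta cong: if_cong)
  then show "v \<in> int_span U" using int_span_memI[of "\<lambda>u. if u = v then 1 else 0" U] by simp
qed

lemma int_span_subset_span: "int_span U \<subseteq> span U"
  unfolding int_span_def by (auto intro: span_sum span_scale span_base)

lemma span_int_span: "finite U \<Longrightarrow> span (int_span U) = span U"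
  using int_span_superset int_span_subset_span
  by (metis span_minimal span_mono subspace_span subset_antisym)

lemma int_span_zero: "0 \<in> int_span U"
  using int_span_memI[of "\<lambda>_. 0" U] by simp

lemma int_span_add: "x \<in> int_span U \<Longrightarrow> y \<in> int_span U \<Longrightarrow> x + y \<in> int_span U"
proof -
  assume "x \<in> int_span U" "y \<in> int_span U"
  then obtain c d where "x = (\<Sum>u\<in>U. of_int (c u) *\<^sub>R u)" "y = (\<Sum>u\<in>U. of_int (d u) *\<^sub>R u)"
    unfolding int_span_def by blast
  then have "x + y = (\<Sum>u\<in>U. of_int (c u + d u) *\<^sub>R u)"
    by (simp add: sum.distrib scaleR_add_left)
  then show ?thesis using int_span_memI[of "\<lambda>u. c u + d u" U] by simp
qed

lemma int_span_uminus: "x \<in> int_span U \<Longrightarrow> - x \<in> int_span U"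
proof -
  assume "x \<in> int_span U"
  then obtain c where "x = (\<Sum>u\<in>U. of_int (c u) *\<^sub>R u)"
    unfolding int_span_def by blast
  then have "- x = (\<Sum>u\<in>U. of_int (- c u) *\<^sub>R u)"
    by (simp add: sum_negf)
  then show ?thesis using int_span_memI[of "\<lambda>u. - c u" U] by simp
qed

lemma int_span_insert:
  assumes "finite U" "v \<notin> U"
  shows "int_span (insert v U) = {of_int k *\<^sub>R v + x | k x. x \<in> int_span U}"
proof
  show "int_span (insert v U) \<subseteq> {of_int k *\<^sub>R v + x | k x. x \<in> int_span U}"
  proof
    fix y assume "y \<in> int_span (insert v U)"
    then obtain c where "y = (\<Sum>u\<in>insert v U. of_int (c u) *\<^sub>R u)"
      unfolding int_span_def by blast
    then have "y = of_int (c v) *\<^sub>R v + (\<Sum>u\<in>U. of_int (c u) *\<^sub>R u)"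
      using assms by simp
    then show "y \<in> {of_int k *\<^sub>R v + x | k x. x \<in> int_span U}"
      using int_span_memI[of c U] by blast
  qed
next
  show "{of_int k *\<^sub>R v + x | k x. x \<in> int_span U} \<subseteq> int_span (insert v U)"
  proof clarify
    fix k :: int and x assume "x \<in> int_span U"
    then obtain c where c: "x = (\<Sum>u\<in>U. of_int (c u) *\<^sub>R u)"
      unfolding int_span_def by blast
    have "(\<Sum>u\<in>U. of_int ((c(v := k)) u) *\<^sub>R u) = (\<Sum>u\<in>U. of_int (c u) *\<^sub>R u)"
      using assms by (intro sum.cong) auto
    then have "of_int k *\<^sub>R v + x = (\<Sum>u\<in>insert v U. of_int ((c(v := k)) u) *\<^sub>R u)"
      using assms c by simp
    then show "of_int k *\<^sub>R v + x \<in> int_span (insert v U)"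
      using int_span_memI[of "c(v := k)" "insert v U"] by simp
  qed
qed

text \<open>Most arguments use a lattice only as an additive subgroup; a basis matters only for
  volumes.\<close>

definition add_subgroup :: "'a::ab_group_add set \<Rightarrow> bool" where
  "add_subgroup P \<longleftrightarrow> 0 \<in> P \<and> (\<forall>x\<in>P. \<forall>y\<in>P. x + y \<in> P) \<and> (\<forall>x\<in>P. - x \<in> P)"

lemma add_subgroup_int_span: "add_subgroup (int_span U)"
  unfolding add_subgroup_def by (simp add: int_span_zero int_span_add int_span_uminus)

lemma add_subgroup_diff: "add_subgroup P \<Longrightarrow> x \<in> P \<Longrightarrow> y \<in> P \<Longrightarrow> x - y \<in> P"
  unfolding add_subgroup_def by (metis diff_conv_add_uminus)

lemma add_subgroup_Int: "add_subgroup P \<Longrightarrow> add_subgroup Q \<Longrightarrow> add_subgroup (P \<inter> Q)"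
  unfolding add_subgroup_def by auto

lemma add_subgroup_of_int_scaleR:
  fixes x :: "'a::real_vector"
  assumes "add_subgroup P" "x \<in> P"
  shows "of_int k *\<^sub>R x \<in> P"
proof -
  have nat: "of_nat n *\<^sub>R x \<in> P" for n
    using assms by (induction n) (auto simp: add_subgroup_def scaleR_add_left)
  show ?thesis
  proof (cases "k \<ge> 0")
    case True
    then show ?thesis using nat[of "nat k"] by simp
  next
    case False
    then have "of_int k *\<^sub>R x = - (of_nat (nat (- k)) *\<^sub>R x)" by simp
    then show ?thesis using nat[of "nat (- k)"] assms by (simp add: add_subgroup_def)
  qed
qed

text \<open>In the induction step the new basis vector is an element of the subgroup whose
  coefficient along the removed generator is positive and minimal.\<close>

lemma is_lattice_subgroup_int_span:
  fixes U :: "'a::euclidean_space set"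
  assumes "finite U" "independent U" "add_subgroup P" "P \<subseteq> int_span U"
  shows "is_lattice P"
proof -
  \<comment> \<open>The clause \<open>B \<subseteq> span U\<close> strengthens the induction: it
    later keeps the new basis vector \<open>w\<close> outside \<open>span B\<close>.\<close>
  have "\<exists>B. finite B \<and> independent B \<and> B \<subseteq> span U \<and> P = int_span B"
    using assms
  proof (induction U arbitrary: P rule: finite_induct)
    case empty
    then have "P = {0}" by (auto simp: int_span_def add_subgroup_def)
    then show ?case by (intro exI[of _ "{}"]) (auto simp: int_span_def independent_empty)
  next
    case (insert v U)
    have vU: "v \<notin> span U" and iU: "independent U"
      using insert.prems(1) insert.hyps by (auto simp: independent_insert)
    define Q where "Q = P \<inter> int_span U"
    have "add_subgroup Q"
      unfolding Q_def using insert.prems(2) add_subgroup_int_span by (rule add_subgroup_Int)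
    then obtain B where B: "finite B" "independent B" "B \<subseteq> span U" "Q = int_span B"
      using insert.IH[of Q] iU Q_def by auto
    have BvU: "B \<subseteq> span (insert v U)" using B(3) span_mono[of U "insert v U"] by auto
    define pos where "pos n \<longleftrightarrow> n > 0 \<and> (\<exists>x\<in>int_span U. of_nat n *\<^sub>R v + x \<in> P)" for n :: nat
    have decomp: "\<exists>k x. y = of_int k *\<^sub>R v + x \<and> x \<in> int_span U" if "y \<in> P" for y
      using that insert.prems(3) int_span_insert[OF insert.hyps(1,2)] by blast
    show ?case
    proof (cases "\<exists>n. pos n")
      case False
      \<comment> \<open>In this case no element of \<open>P\<close> has a nonzero coefficient at
        \<open>v\<close>: a negative coefficient would become positive under negation.\<close>
      have "P \<subseteq> int_span U"
      proof
        fix y assume y: "y \<in> P"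
        obtain k x where kx: "y = of_int k *\<^sub>R v + x" "x \<in> int_span U" using decomp[OF y] by blast
        have "k = 0"
        proof (rule ccontr)
          assume "k \<noteq> 0"
          then consider "k > 0" | "k < 0" by linarith
          then show False
          proof cases
            case 1
            then have "pos (nat k)" unfolding pos_def using kx y by auto
            then show False using False by blast
          next
            case 2
            have "- y \<in> P" using y insert.prems(2) by (simp add: add_subgroup_def)
            moreover have "- y = of_nat (nat (- k)) *\<^sub>R v + (- x)" using kx 2 by simp
            ultimately have "of_nat (nat (- k)) *\<^sub>R v + (- x) \<in> P" by (simp only:)
            then have "pos (nat (- k))" unfolding pos_def using 2 int_span_uminus[OF kx(2)]
              by (intro conjI bexI[of _ "- x"]) simp_all
            then show False using False by blast
          qed
        qed
        then show "y \<in> int_span U" using kx by simp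
      qed
      then have "Q = P" unfolding Q_def by auto
      then show ?thesis using B BvU by blast
    next
      case True
      define n where "n = (LEAST n. pos n)"
      have n: "pos n" unfolding n_def using True by (rule LeastI_ex)
      have nmin: "\<not> pos m" if "m < n" for m using that not_less_Least unfolding n_def by blast
      obtain x0 where x0: "x0 \<in> int_span U" "of_nat n *\<^sub>R v + x0 \<in> P" "n > 0"
        using n unfolding pos_def by blast
      define w where "w = of_nat n *\<^sub>R v + x0"
      have wP: "w \<in> P" using x0 w_def by simp
      have x0s: "x0 \<in> span U" using x0 int_span_subset_span by blast
      have wU: "w \<notin> span U"
      proof
        assume "w \<in> span U"
        then have "w - x0 \<in> span U" using x0s by (rule span_diff)
        then have "of_nat n *\<^sub>R v \<in> span U" unfolding w_def by simp
        then have "(1 / of_nat n) *\<^sub>R (of_nat n *\<^sub>R v) \<in> span U" by (rule span_scale)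
        then show False using vU x0(3) by simp
      qed
      have wB: "w \<notin> span B" using wU B(3) span_minimal[OF B(3) subspace_span] by blast
      then have wnB: "w \<notin> B" using span_base by blast
      have ind: "independent (insert w B)" using B(2) wB wnB by (simp add: independent_insert)
      have ws: "w \<in> span (insert v U)"
        unfolding w_def using x0s span_mono[of U "insert v U"] span_base[of v "insert v U"]
        by (intro span_add span_scale) blast+
      have "P = int_span (insert w B)"
        unfolding int_span_insert[OF B(1) wnB]
      proof
        have "int_span B \<subseteq> P" using B(4) Q_def by blast
        moreover have "of_int k *\<^sub>R w \<in> P" for k
          using insert.prems(2) wP by (rule add_subgroup_of_int_scaleR)
        ultimately show "{of_int k *\<^sub>R w + x | k x. x \<in> int_span B} \<subseteq> P"
          using insert.prems(2) unfolding add_subgroup_def by blast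
        show "P \<subseteq> {of_int k *\<^sub>R w + x | k x. x \<in> int_span B}"
        proof
          fix y assume y: "y \<in> P"
          obtain k x where kx: "y = of_int k *\<^sub>R v + x" "x \<in> int_span U" using decomp[OF y] by blast
          \<comment> \<open>Division with remainder by the least positive coefficient
            \<open>n\<close>. Subtracting \<open>q\<close> copies of \<open>w\<close> leaves an
            element of \<open>P\<close> with coefficient \<open>r < n\<close>, so
            \<open>r = 0\<close> by minimality and the remainder lies in \<open>Q\<close>.\<close>
          define q r where "q = k div int n" and "r = k mod int n"
          have kqr: "k = q * int n + r" unfolding q_def r_def by simp
          have r: "0 \<le> r" "r < int n" unfolding r_def using x0(3) by auto
          define z where "z = y - of_int q *\<^sub>R w"
          have zP: "z \<in> P" unfolding z_def
            using add_subgroup_diff[OF insert.prems(2) y] add_subgroup_of_int_scaleR[OF insert.prems(2) wP] by blast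
          define x' where "x' = x - of_int q *\<^sub>R x0"
          have x'U: "x' \<in> int_span U" unfolding x'_def
            using add_subgroup_diff[OF add_subgroup_int_span kx(2)]
              add_subgroup_of_int_scaleR[OF add_subgroup_int_span x0(1)] by blast
          have zr: "z = of_int r *\<^sub>R v + x'"
            unfolding z_def kx(1) w_def x'_def kqr by (simp add: algebra_simps)
          have "r = 0"
          proof (rule ccontr)
            assume "r \<noteq> 0"
            then have "pos (nat r)" unfolding pos_def using zr zP x'U r by auto
            then show False using nmin[of "nat r"] r by auto
          qed
          then have "z \<in> int_span B" using zr zP x'U B(4) Q_def by auto
          then show "y \<in> {of_int k *\<^sub>R w + x | k x. x \<in> int_span B}"
            unfolding z_def by (intro CollectI exI[of _ q] exI[of _ "y - of_int q *\<^sub>R w"]) auto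
        qed
      qed
      then show ?thesis using ind B(1) BvU ws by (intro exI[of _ "insert w B"]) auto
    qed
  qed
  then show ?thesis unfolding is_lattice_def by blast
qed

lemma is_lattice_subgroup:
  assumes "is_lattice L" "add_subgroup P" "P \<subseteq> L"
  shows "is_lattice P"
  using assms is_lattice_subgroup_int_span unfolding is_lattice_def by blast

lemma add_subgroup_lattice: "is_lattice L \<Longrightarrow> add_subgroup L"
  unfolding is_lattice_def using add_subgroup_int_span by blast

section \<open>Unit cells as fundamental domains of the lattice translations\<close>

lemma unit_cell_covers:
  assumes "finite U" "x \<in> span U"
  obtains w where "w \<in> int_span U" "x + w \<in> unit_cell U"
proof -
  obtain c where c: "x = (\<Sum>u\<in>U. c u *\<^sub>R u)"
    using assms span_finite[of U] by auto
  \<comment> \<open>Removing the integer parts of the coordinates leaves their fractional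
    parts.\<close>
  define w where "w = (\<Sum>u\<in>U. of_int (- \<lfloor>c u\<rfloor>) *\<^sub>R u)"
  have "x + w = (\<Sum>u\<in>U. frac (c u) *\<^sub>R u)"
    unfolding w_def c frac_def by (simp add: scaleR_diff_left sum_negf sum_subtractf)
  then have "x + w \<in> unit_cell U"
    unfolding unit_cell_def by (intro CollectI exI[of _ "\<lambda>u. frac (c u)"]) (simp add: frac_lt_1)
  moreover have "w \<in> int_span U" unfolding w_def by (rule int_span_memI)
  ultimately show ?thesis using that by blast
qed

text \<open>By independence the coefficients can be compared one by one: each coefficient of
  \<open>w\<close> is an integer and a difference of two numbers in [0,1), hence 0.\<close>

lemma unit_cell_translate_unique:
  assumes "finite U" "independent U" "x \<in> unit_cell U" "x + w \<in> unit_cell U" "w \<in> int_span U"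
  shows "w = 0"
proof -
  obtain c where c: "x = (\<Sum>u\<in>U. c u *\<^sub>R u)" "\<forall>u\<in>U. 0 \<le> c u \<and> c u < 1"
    using assms unfolding unit_cell_def by blast
  obtain d where d: "x + w = (\<Sum>u\<in>U. d u *\<^sub>R u)" "\<forall>u\<in>U. 0 \<le> d u \<and> d u < 1"
    using assms unfolding unit_cell_def by blast
  obtain k where k: "w = (\<Sum>u\<in>U. of_int (k u) *\<^sub>R u)"
    using assms unfolding int_span_def by blast
  have "(\<Sum>u\<in>U. (c u + of_int (k u) - d u) *\<^sub>R u) =
      (\<Sum>u\<in>U. c u *\<^sub>R u) + (\<Sum>u\<in>U. of_int (k u) *\<^sub>R u) - (\<Sum>u\<in>U. d u *\<^sub>R u)"
    by (simp add: algebra_simps sum.distrib sum_subtractf)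
  then have z: "(\<Sum>u\<in>U. (c u + of_int (k u) - d u) *\<^sub>R u) = 0"
    unfolding c(1)[symmetric] k[symmetric] d(1)[symmetric] by simp
  have "k u = 0" if u: "u \<in> U" for u
  proof -
    have "c u + of_int (k u) - d u = 0"
      using independentD[OF assms(2,1) subset_refl z u] .
    then have "of_int (k u) < (1::real)" "of_int (k u) > (-1::real)"
      using c(2) d(2) u by (smt (verit))+
    then show ?thesis by linarith
  qed
  then show ?thesis unfolding k by simp
qed

text \<open>Lattice vectors index the pieces in the volume comparison, so countable additivity
  requires this.\<close>

lemma countable_int_span: "finite U \<Longrightarrow> countable (int_span U)"
proof (induction U rule: finite_induct)
  case empty
  then show ?case by (simp add: int_span_def)
next
  case (insert v U)
  have "int_span (insert v U) = (\<lambda>(k::int, x). of_int k *\<^sub>R v + x) ` (UNIV \<times> int_span U)"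
    unfolding int_span_insert[OF insert.hyps(1,2)] by auto
  then show ?case using insert.IH by simp
qed

text \<open>\<open>representation\<close> is linear in \<open>x\<close>, which turns the existential
  over coefficients into linear inequalities and makes measurability accessible.\<close>

lemma unit_cell_eq_representation:
  assumes "finite U" "independent U"
  shows "unit_cell U = {x \<in> span U. \<forall>u\<in>U. 0 \<le> representation U x u \<and> representation U x u < 1}"
proof (intro equalityI subsetI)
  fix x assume "x \<in> unit_cell U"
  then obtain c where c: "x = (\<Sum>u\<in>U. c u *\<^sub>R u)" "\<forall>u\<in>U. 0 \<le> c u \<and> c u < 1"
    unfolding unit_cell_def by blast
  have xs: "x \<in> span U" unfolding c(1) by (intro span_sum span_scale span_base)
  have "representation U x u = c u" if u: "u \<in> U" for u
  proof -
    have "(\<Sum>u\<in>U. representation U x u *\<^sub>R u) = x"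
      using assms xs by (intro sum_representation_eq) auto
    then have "(\<Sum>u\<in>U. (representation U x u - c u) *\<^sub>R u) = 0"
      using c(1) by (simp add: scaleR_diff_left sum_subtractf)
    from independentD[OF assms(2,1) subset_refl this u] show ?thesis by simp
  qed
  then show "x \<in> {x \<in> span U. \<forall>u\<in>U. 0 \<le> representation U x u \<and> representation U x u < 1}"
    using xs c(2) by auto
next
  fix x assume x: "x \<in> {x \<in> span U. \<forall>u\<in>U. 0 \<le> representation U x u \<and> representation U x u < 1}"
  then have "(\<Sum>u\<in>U. representation U x u *\<^sub>R u) = x"
    using assms by (intro sum_representation_eq) auto
  then show "x \<in> unit_cell U" unfolding unit_cell_def using x
    by (intro CollectI exI[of _ "representation U x"]) auto
qed

section \<open>Monotonicity of the lattice volume\<close>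

text \<open>A product measure is determined by its values on boxes, where the claim reduces to
  translation invariance of \<open>lborel\<close> in each coordinate.\<close>

lemma emeasure_PiM_lborel_translate:
  fixes I :: "'i set"
  assumes "finite I" and A: "A \<in> sets (PiM I (\<lambda>_. lborel :: real measure))"
  shows "(\<lambda>f. \<lambda>i\<in>I. f i + v i) \<in> measurable (PiM I (\<lambda>_. lborel :: real measure)) (PiM I (\<lambda>_. lborel))"
    and "emeasure (PiM I (\<lambda>_. lborel)) ((\<lambda>f. \<lambda>i\<in>I. f i + v i) -` A \<inter> space (PiM I (\<lambda>_. lborel)))
       = emeasure (PiM I (\<lambda>_. lborel)) A"
proof -
  interpret product_sigma_finite "\<lambda>_::'i. lborel :: real measure"
    by (rule product_sigma_finite.intro) (rule sigma_finite_lborel)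
  let ?M = "PiM I (\<lambda>_. lborel :: real measure)"
  let ?t = "\<lambda>f. \<lambda>i\<in>I. f i + v i"
  show m: "?t \<in> measurable ?M ?M"
    by (rule measurable_restrict) simp
  have "distr ?M ?M ?t = ?M"
  proof (rule PiM_eqI)
    show "finite I" by fact
    show "sets (distr ?M ?M ?t) = sets ?M" by simp
    fix B :: "'i \<Rightarrow> real set" assume B: "\<And>i. i \<in> I \<Longrightarrow> B i \<in> sets lborel"
    define C where "C i = (+) (v i) -` B i" for i
    have C: "C i \<in> sets lborel" if "i \<in> I" for i
      using measurable_sets[of "(+) (v i)" borel borel "B i"] B[OF that] unfolding C_def by simp
    have eq: "?t -` Pi\<^sub>E I B \<inter> space ?M = Pi\<^sub>E I C"
      by (auto simp: space_PiM C_def PiE_def Pi_def extensional_def add.commute)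
    have "emeasure (distr ?M ?M ?t) (Pi\<^sub>E I B) = emeasure ?M (Pi\<^sub>E I C)"
      using m B \<open>finite I\<close> by (subst emeasure_distr) (auto simp: eq intro!: sets_PiM_I_finite)
    also have "\<dots> = (\<Prod>i\<in>I. emeasure lborel (C i))"
      using \<open>finite I\<close> C by (rule emeasure_PiM)
    also have "\<dots> = (\<Prod>i\<in>I. emeasure lborel (B i))"
    proof (rule prod.cong)
      fix i assume i: "i \<in> I"
      have "emeasure lborel (B i) = emeasure (distr lborel borel ((+) (v i))) (B i)"
        by (simp add: lborel_distr_plus)
      also have "\<dots> = emeasure lborel (C i)"
        using B[OF i] by (subst emeasure_distr) (auto simp: C_def)
      finally show "emeasure lborel (C i) = emeasure lborel (B i)" by simp
    qed simp
    finally show "emeasure (distr ?M ?M ?t) (Pi\<^sub>E I B) = (\<Prod>i\<in>I. emeasure lborel (B i))" .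
  qed
  then have "emeasure ?M A = emeasure (distr ?M ?M ?t) A" by simp
  also have "\<dots> = emeasure ?M (?t -` A \<inter> space ?M)"
    using m A by (rule emeasure_distr)
  finally show "emeasure ?M (?t -` A \<inter> space ?M) = emeasure ?M A" by simp
qed

text \<open>Cut \<open>D'\<close> into the pieces sent into \<open>D\<close> by a group element, and move each piece into \<open>D\<close>.
  The moved pieces remain disjoint because no two points of \<open>D'\<close> lie in one orbit.\<close>

lemma emeasure_fundamental_domain_le:
  assumes I: "countable I" and D: "D \<in> sets M" "D' \<in> sets M"
    and meas: "\<And>w. w \<in> I \<Longrightarrow> S w \<in> measurable M M" "\<And>w. w \<in> I \<Longrightarrow> R w \<in> measurable M M"
    and pres: "\<And>w A. w \<in> I \<Longrightarrow> A \<in> sets M \<Longrightarrow> emeasure M (S w -` A \<inter> space M) = emeasure M A"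
    and inverse: "\<And>w x. w \<in> I \<Longrightarrow> x \<in> space M \<Longrightarrow> R w (S w x) = x"
    and cover: "\<And>x. x \<in> D' \<Longrightarrow> \<exists>w\<in>I. S w x \<in> D"
    and unique: "\<And>x w w'. x \<in> D' \<Longrightarrow> w \<in> I \<Longrightarrow> w' \<in> I \<Longrightarrow> S w x \<in> D \<Longrightarrow> S w' x \<in> D \<Longrightarrow> w = w'"
    and separate: "\<And>x w w'. x \<in> D \<Longrightarrow> w \<in> I \<Longrightarrow> w' \<in> I \<Longrightarrow> R w x \<in> D' \<Longrightarrow> R w' x \<in> D' \<Longrightarrow> w = w'"
  shows "emeasure M D' \<le> emeasure M D"
proof -
  \<comment> \<open>The piece \<open>X w\<close> of \<open>D'\<close> is the preimage of
    \<open>Y w\<close> under \<open>S w\<close>, so both have the same measure. Writing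
    \<open>Y w\<close> through the inverse \<open>R w\<close> instead of as an image makes it
    measurable.\<close>
  define X where "X w = D' \<inter> (S w -` D \<inter> space M)" for w
  define Y where "Y w = D \<inter> (R w -` D' \<inter> space M)" for w
  have sub: "D' \<subseteq> space M" "D \<subseteq> space M" using D sets.sets_into_space by auto
  have X: "X w \<in> sets M" if "w \<in> I" for w
    unfolding X_def using D measurable_sets[OF meas(1)[OF that]] by auto
  have Y: "Y w \<in> sets M" if "w \<in> I" for w
    unfolding Y_def using D measurable_sets[OF meas(2)[OF that]] by auto
  have "emeasure M (X w) = emeasure M (Y w)" if w: "w \<in> I" for w
  proof -
    have "X w = S w -` Y w \<inter> space M"
      unfolding X_def Y_def using inverse[OF w] sub measurable_space[OF meas(1)[OF w]] by auto
    then show ?thesis using pres[OF w Y[OF w]] by simp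
  qed
  note XY = this
  have "D' = (\<Union>w\<in>I. X w)"
  proof (intro equalityI subsetI)
    fix x assume x: "x \<in> D'"
    then obtain w where "w \<in> I" "S w x \<in> D" using cover by metis
    then show "x \<in> (\<Union>w\<in>I. X w)" using x sub(1) unfolding X_def by blast
  qed (auto simp: X_def)
  then have "emeasure M D' = emeasure M (\<Union>w\<in>I. X w)" by simp
  also have "\<dots> = (\<integral>\<^sup>+w. emeasure M (X w) \<partial>count_space I)"
  proof (rule emeasure_UN_countable[OF X I])
    show "disjoint_family_on X I"
      unfolding disjoint_family_on_def X_def using unique by fast
  qed
  also have "\<dots> = (\<integral>\<^sup>+w. emeasure M (Y w) \<partial>count_space I)"
    using XY by (intro nn_integral_cong) simp
  also have "\<dots> = emeasure M (\<Union>w\<in>I. Y w)"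
  proof (rule emeasure_UN_countable[OF Y I, symmetric])
    show "disjoint_family_on Y I"
      unfolding disjoint_family_on_def Y_def using separate by fast
  qed
  also have "\<dots> \<le> emeasure M D"
    using D by (intro emeasure_mono) (auto simp: Y_def)
  finally show ?thesis .
qed

text \<open>Guarantees that the basis selected by choice in \<open>pvol\<close> really is
  orthonormal and spans \<open>V\<close>.\<close>

lemma exists_orthonormal_sequence:
  fixes V :: "'a::euclidean_space set"
  assumes "subspace V" "dim V = p"
  shows "\<exists>b :: nat \<Rightarrow> 'a. (\<forall>i<p. \<forall>j<p. b i \<bullet> b j = (if i = j then 1 else 0)) \<and> span (b ` {..<p}) = V"
proof -
  obtain B where B: "B \<subseteq> V" "pairwise orthogonal B" "\<And>x. x \<in> B \<Longrightarrow> norm x = 1"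
      "independent B" "card B = dim V" "span B = V"
    using orthonormal_basis_subspace[OF assms(1)] by metis
  have "finite B" using B(4) by (rule independent_imp_finite)
  then obtain b where b: "bij_betw b {..<p} B"
    using B(5) assms(2) ex_bij_betw_nat_finite[of B] by (auto simp: atLeast0LessThan)
  have bB: "b i \<in> B" if "i < p" for i using b that by (auto simp: bij_betw_def)
  have "b i \<bullet> b j = (if i = j then 1 else 0)" if "i < p" "j < p" for i j
  proof (cases "i = j")
    case True
    then show ?thesis using B(3)[OF bB[OF that(1)]] by (simp add: norm_eq_1)
  next
    case False
    then have "b i \<noteq> b j" using b that by (auto simp: bij_betw_def inj_on_def)
    then show ?thesis using False B(2) bB that by (auto simp: pairwise_def orthogonal_def)
  qed
  moreover have "span (b ` {..<p}) = V" using b B(6) by (simp add: bij_betw_def)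
  ultimately show ?thesis by blast
qed

section \<open>Coordinates in an orthonormal basis and the measure of unit cells\<close>

locale orthonormal_sequence =
  fixes b :: "nat \<Rightarrow> 'a::euclidean_space" and p :: nat
  assumes ortho: "\<And>i j. i < p \<Longrightarrow> j < p \<Longrightarrow> b i \<bullet> b j = (if i = j then 1 else 0)"
begin

abbreviation PM :: "(nat \<Rightarrow> real) measure" where
  "PM \<equiv> PiM {..<p} (\<lambda>_. lborel)"

text \<open>The coordinate map inside \<open>pvol\<close>, kept extensional so that its values lie
  in the space of \<open>PM\<close>.\<close>

definition coords :: "'a \<Rightarrow> nat \<Rightarrow> real" where
  "coords x = (\<lambda>i\<in>{..<p}. x \<bullet> b i)"

definition combine :: "(nat \<Rightarrow> real) \<Rightarrow> 'a" where
  "combine f = (\<Sum>i<p. f i *\<^sub>R b i)"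

lemma combine_in_span: "combine f \<in> span (b ` {..<p})"
  unfolding combine_def by (intro span_sum span_scale span_base) auto

lemma coords_combine: "f \<in> extensional {..<p} \<Longrightarrow> coords (combine f) = f"
proof
  fix i assume f: "f \<in> extensional {..<p}"
  show "coords (combine f) i = f i"
  proof (cases "i < p")
    case True
    then have "coords (combine f) i = (\<Sum>j<p. f j * (if j = i then 1 else 0))"
      unfolding coords_def combine_def by (simp add: inner_sum_left ortho)
    also have "\<dots> = f i" using True by (simp add: sum.delta if_distrib[of "(*) _"] cong: if_cong)
    finally show ?thesis .
  next
    case False
    then show ?thesis using f by (simp add: coords_def extensional_def)
  qed
qed

lemma coords_extensional: "coords x \<in> extensional {..<p}"
  by (simp add: coords_def)

text \<open>Both sides are linear in \<open>x\<close> and agree on the basis vectors, hence on their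
  span.\<close>

lemma combine_coords:
  assumes "x \<in> span (b ` {..<p})"
  shows "combine (coords x) = x"
proof -
  have "linear (\<lambda>x. combine (coords x))"
    unfolding combine_def coords_def
    by (rule linearI) (simp_all add: inner_add_left scaleR_add_left sum.distrib scaleR_sum_right)
  moreover have "combine (coords x) = x" if x: "x \<in> b ` {..<p}" for x
  proof -
    obtain k where k: "k < p" "x = b k" using x by auto
    have "combine (coords x) = (\<Sum>i<p. (if i = k then 1 else 0) *\<^sub>R b i)"
      unfolding combine_def coords_def k(2) using k(1) ortho by (intro sum.cong) auto
    also have "\<dots> = b k" using k(1) by (simp add: if_distrib[of "\<lambda>c. c *\<^sub>R _"] sum.delta cong: if_cong)
    finally show ?thesis using k by simp
  qed
  ultimately show ?thesis
    using linear_eq_on_span[OF _ linear_id, of "\<lambda>x. combine (coords x)" "b ` {..<p}" x] assms by simp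
qed

lemma coords_add: "coords (x + w) = (\<lambda>i\<in>{..<p}. coords x i + coords w i)"
  by (auto simp: coords_def inner_add_left)

text \<open>Replaces the image occurring in \<open>pvol\<close> by a preimage under
  \<open>combine\<close>, whose measurability can be read off.\<close>

lemma coords_image: "A \<subseteq> span (b ` {..<p}) \<Longrightarrow> coords ` A = {f \<in> space PM. combine f \<in> A}"
proof (intro equalityI subsetI)
  fix f assume "A \<subseteq> span (b ` {..<p})" "f \<in> coords ` A"
  then show "f \<in> {f \<in> space PM. combine f \<in> A}"
    using combine_coords coords_extensional by (auto simp: space_PiM PiE_def)
next
  fix f assume "f \<in> {f \<in> space PM. combine f \<in> A}"
  then show "f \<in> coords ` A"
    using coords_combine[of f] by (auto simp: space_PiM PiE_def intro!: image_eqI[of f coords "combine f"])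
qed

text \<open>In coordinates the unit cell is cut out by finitely many inequalities between linear
  functions.\<close>

lemma sets_coords_unit_cell:
  assumes U: "finite U" "independent U" "span U = span (b ` {..<p})"
  shows "coords ` unit_cell U \<in> sets PM"
proof -
  have bU: "b i \<in> span U" if "i < p" for i
    unfolding U(3) using that by (intro span_base) auto
  have rep: "representation U (combine f) u = (\<Sum>i<p. f i * representation U (b i) u)" for f u
  proof -
    have "representation U (combine f) u = (\<Sum>i<p. representation U (f i *\<^sub>R b i) u)"
      unfolding combine_def using bU by (subst representation_sum[OF U(2)]) (auto intro: span_scale)
    also have "\<dots> = (\<Sum>i<p. f i * representation U (b i) u)"
      using bU representation_scale[OF U(2)] by (intro sum.cong) auto
    finally show ?thesis .
  qed
  have "unit_cell U \<subseteq> span (b ` {..<p})"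
    unfolding unit_cell_eq_representation[OF U(1,2)] U(3) by auto
  then have "coords ` unit_cell U = {f \<in> space PM. combine f \<in> unit_cell U}"
    by (rule coords_image)
  also have "\<dots> = {f \<in> space PM. \<forall>u\<in>U. 0 \<le> (\<Sum>i<p. f i * representation U (b i) u) \<and>
      (\<Sum>i<p. f i * representation U (b i) u) < 1}"
    unfolding unit_cell_eq_representation[OF U(1,2)] using combine_in_span U(3) rep by auto
  also have "\<dots> \<in> sets PM"
    using U(1) by measurable
  finally show ?thesis .
qed

text \<open>The unit cell is bounded, so its coordinates lie in a box. Finiteness is what lets an
  inequality of \<open>emeasure\<close> pass to \<open>measure\<close>, which is 0 on sets of
  infinite measure.\<close>

lemma emeasure_coords_unit_cell_finite:
  assumes U: "finite U" "independent U" "span U = span (b ` {..<p})"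
  shows "emeasure PM (coords ` unit_cell U) < \<infinity>"
proof -
  interpret product_sigma_finite "\<lambda>_::nat. lborel :: real measure"
    by (rule product_sigma_finite.intro) (rule sigma_finite_lborel)
  define r where "r = (\<Sum>u\<in>U. norm u)"
  have "norm x \<le> r" if x: "x \<in> unit_cell U" for x
  proof -
    obtain c where c: "x = (\<Sum>u\<in>U. c u *\<^sub>R u)" "\<forall>u\<in>U. 0 \<le> c u \<and> c u < 1"
      using x unfolding unit_cell_def by blast
    have "norm (c u *\<^sub>R u) \<le> norm u" if "u \<in> U" for u
      using c(2) that mult_left_le_one_le[of "norm u" "c u"] by (auto simp: less_imp_le)
    then show ?thesis unfolding c(1) r_def by (intro order_trans[OF norm_sum] sum_mono)
  qed
  moreover have "\<bar>x \<bullet> b i\<bar> \<le> norm x" if "i < p" for x i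
  proof -
    have "norm (b i) = 1" using ortho[of i i] that by (simp add: norm_eq_1)
    then show ?thesis using Cauchy_Schwarz_ineq2[of x "b i"] by simp
  qed
  ultimately have "\<bar>x \<bullet> b i\<bar> \<le> r" if "x \<in> unit_cell U" "i < p" for x i
    using that by (meson order_trans)
  then have "coords ` unit_cell U \<subseteq> Pi\<^sub>E {..<p} (\<lambda>_. {-r..r})"
    by (intro image_subsetI PiE_I) (simp_all add: coords_def abs_le_iff minus_le_iff)
  then have "emeasure PM (coords ` unit_cell U) \<le> emeasure PM (Pi\<^sub>E {..<p} (\<lambda>_. {-r..r}))"
    by (intro emeasure_mono sets_PiM_I_finite) auto
  also have "\<dots> = (\<Prod>i<p. emeasure lborel {-r..r})"
    by (rule emeasure_PiM) auto
  also have "\<dots> < \<infinity>"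
  proof -
    have "0 \<le> r" unfolding r_def by (simp add: sum_nonneg)
    then show ?thesis by (simp add: emeasure_lborel_Icc_eq ennreal_power)
  qed
  finally show ?thesis .
qed

text \<open>The coarser lattice \<open>int_span U\<close> acts by translations. The cell of
  \<open>U\<close> meets every orbit exactly once, while the cell of \<open>U'\<close> meets it at
  most once, because two of its points differing by a vector of the finer lattice coincide.\<close>

lemma measure_unit_cell_antimono:
  assumes U: "finite U" "independent U" "span U = span (b ` {..<p})"
    and U': "finite U'" "independent U'" "span U' = span (b ` {..<p})"
    and le: "int_span U \<subseteq> int_span U'"
  shows "measure PM (coords ` unit_cell U') \<le> measure PM (coords ` unit_cell U)"
proof -
  define S where "S w f = (\<lambda>i\<in>{..<p}. f i + coords w i)" for w f
  define R where "R w f = (\<lambda>i\<in>{..<p}. f i + coords (- w) i)" for w f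
  have S: "S w (coords x) = coords (x + w)" for w x
    unfolding S_def coords_add ..
  have R: "R w (coords x) = coords (x - w)" for w x
    unfolding R_def coords_add[symmetric] by simp
  have inj: "x = y" if "coords x = coords y" "x \<in> span (b ` {..<p})" "y \<in> span (b ` {..<p})" for x y
    using that combine_coords by metis
  have sub: "unit_cell U \<subseteq> span (b ` {..<p})" "unit_cell U' \<subseteq> span (b ` {..<p})"
    unfolding unit_cell_eq_representation[OF U(1,2)] unit_cell_eq_representation[OF U'(1,2)] U(3) U'(3)
    by auto
  have lsub: "int_span U \<subseteq> span (b ` {..<p})"
    using int_span_subset_span[of U] U(3) by simp
  have mem: "x \<in> A" if "coords x \<in> coords ` A" "x \<in> span (b ` {..<p})" "A \<subseteq> span (b ` {..<p})" for x A
    using that inj by blast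
  have "emeasure PM (coords ` unit_cell U') \<le> emeasure PM (coords ` unit_cell U)"
  proof (rule emeasure_fundamental_domain_le[where I = "int_span U" and S = S and R = R])
    show "countable (int_span U)" using U(1) by (rule countable_int_span)
    show "coords ` unit_cell U \<in> sets PM" using U by (rule sets_coords_unit_cell)
    show "coords ` unit_cell U' \<in> sets PM" using U' by (rule sets_coords_unit_cell)
    show "S w \<in> measurable PM PM" "R w \<in> measurable PM PM" for w
      unfolding S_def R_def by (rule emeasure_PiM_lborel_translate[OF finite_lessThan sets.empty_sets])+
    show "emeasure PM (S w -` A \<inter> space PM) = emeasure PM A" if "A \<in> sets PM" for w A
      unfolding S_def using emeasure_PiM_lborel_translate(2)[OF finite_lessThan that] by simp
    show "R w (S w f) = f" if "f \<in> space PM" for w f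
      using that unfolding R_def S_def coords_def
      by (auto simp: space_PiM PiE_def extensional_def fun_eq_iff)
    show "\<exists>w\<in>int_span U. S w f \<in> coords ` unit_cell U" if f: "f \<in> coords ` unit_cell U'" for f
    proof -
      obtain x where x: "f = coords x" "x \<in> span U" using f sub U(3) by auto
      then show ?thesis using unit_cell_covers[OF U(1) x(2)] S by (metis imageI)
    qed
    show "w = w'"
      if f: "f \<in> coords ` unit_cell U'" and w: "w \<in> int_span U" "w' \<in> int_span U"
        and m: "S w f \<in> coords ` unit_cell U" "S w' f \<in> coords ` unit_cell U" for f w w'
    proof -
      obtain x where x: "f = coords x" "x \<in> span (b ` {..<p})" using f sub by auto
      have "x + w \<in> unit_cell U" "x + w' \<in> unit_cell U"
        using m w lsub sub(1) x mem[of "x + w" "unit_cell U"] mem[of "x + w'" "unit_cell U"]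
        by (auto simp: S intro: span_add)
      moreover have "w' - w \<in> int_span U"
        using add_subgroup_diff[OF add_subgroup_int_span w(2,1)] .
      ultimately have "w' - w = 0"
        using unit_cell_translate_unique[OF U(1,2), of "x + w" "w' - w"] by simp
      then show "w = w'" by simp
    qed
    show "w = w'"
      if f: "f \<in> coords ` unit_cell U" and w: "w \<in> int_span U" "w' \<in> int_span U"
        and m: "R w f \<in> coords ` unit_cell U'" "R w' f \<in> coords ` unit_cell U'" for f w w'
    proof -
      obtain x where x: "f = coords x" "x \<in> span (b ` {..<p})" using f sub by auto
      have "x - w \<in> unit_cell U'" "x - w' \<in> unit_cell U'"
        using m w lsub sub(2) x mem[of "x - w" "unit_cell U'"] mem[of "x - w'" "unit_cell U'"]
        by (auto simp: R intro: span_diff)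
      moreover have "w - w' \<in> int_span U'"
        using add_subgroup_diff[OF add_subgroup_int_span w] le by blast
      ultimately have "w - w' = 0"
        using unit_cell_translate_unique[OF U'(1,2), of "x - w" "w - w'"] by simp
      then show "w = w'" by simp
    qed
  qed
  then show ?thesis
    unfolding measure_def using emeasure_coords_unit_cell_finite[OF U] by (intro enn2real_mono) auto
qed

end

text \<open>Inclusion and equal dimension force equal spans, so \<open>pvol\<close> selects the same
  orthonormal basis for both lattices and the two unit cells are measured in the same
  coordinates.\<close>

lemma lattice_vol_antimono:
  fixes P P' :: "'a::euclidean_space set"
  assumes "is_lattice P" "is_lattice P'" "P \<subseteq> P'" "lattice_dim P = lattice_dim P'"
  shows "lattice_vol P' \<le> lattice_vol P"
proof -
  define V where "V = span P"
  define p where "p = dim P"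
  have V': "span P' = V"
    unfolding V_def using assms(3,4) span_mono[OF assms(3)]
    by (metis dim_span lattice_dim_def subspace_dim_equal subspace_span order_refl)
  define chosen where "chosen Q = (SOME U. finite U \<and> independent U \<and> Q = int_span U)" for Q :: "'a set"
  have chosen: "finite (chosen Q) \<and> independent (chosen Q) \<and> Q = int_span (chosen Q)"
    if "is_lattice Q" for Q
    using that unfolding is_lattice_def chosen_def by (rule someI_ex)
  have span_chosen: "span (chosen Q) = span Q" and card_chosen: "card (chosen Q) = dim Q"
    if "is_lattice Q" for Q
  proof -
    show s: "span (chosen Q) = span Q" using chosen[OF that] span_int_span by metis
    show "card (chosen Q) = dim Q"
      using chosen[OF that] dim_eq_card_independent dim_span s by metis
  qed
  \<comment> \<open>Literally the term chosen inside \<open>pvol\<close>, so that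
    \<open>lattice_vol\<close> unfolds to a measure in the coordinates of the locale.\<close>
  define b where "b = (SOME b :: nat \<Rightarrow> 'a. (\<forall>i<p. \<forall>j<p. b i \<bullet> b j = (if i = j then 1 else 0))
                                            \<and> span (b ` {..<p}) = V)"
  have b: "(\<forall>i<p. \<forall>j<p. b i \<bullet> b j = (if i = j then 1 else 0)) \<and> span (b ` {..<p}) = V"
    using someI_ex[OF exists_orthonormal_sequence[of V p]] unfolding b_def[symmetric]
    by (simp add: V_def p_def)
  interpret orthonormal_sequence b p using b by unfold_locales auto
  have vol: "lattice_vol Q = measure PM (coords ` unit_cell (chosen Q))"
    if "is_lattice Q" "span Q = V" "dim Q = p" for Q
    unfolding lattice_vol_def chosen_def[symmetric] Let_def pvol_def
    unfolding span_chosen[OF that(1)] card_chosen[OF that(1)] that(2,3) b_def[symmetric] coords_def ..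
  have "dim P' = p" using assms(4) by (simp add: p_def lattice_dim_def)
  then have "lattice_vol P' = measure PM (coords ` unit_cell (chosen P'))"
    using vol[OF assms(2) V'] by simp
  also have "\<dots> \<le> measure PM (coords ` unit_cell (chosen P))"
    using chosen[OF assms(1)] chosen[OF assms(2)] span_chosen[OF assms(1)] span_chosen[OF assms(2)]
      b V' V_def assms(3)
    by (intro measure_unit_cell_antimono) auto
  also have "\<dots> = lattice_vol P" using vol[OF assms(1)] by (simp add: V_def p_def)
  finally show ?thesis .
qed

section \<open>Shadows and periodicity lattices\<close>

lemma topspace_qtop: "topspace (qtop X f) = f ` topspace X"
proof
  show "topspace (qtop X f) \<subseteq> f ` topspace X"
    using openin_topspace[of "qtop X f"] unfolding openin_qtop by simp
  have "openin (qtop X f) (f ` topspace X)"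
    unfolding openin_qtop by (auto simp: Collect_conj_eq intro: back_subst[of "openin X", OF openin_topspace])
  then show "f ` topspace X \<subseteq> topspace (qtop X f)" by (rule openin_subset)
qed

lemma closedin_qtop:
  "closedin (qtop X f) C \<longleftrightarrow> C \<subseteq> f ` topspace X \<and> closedin X {x \<in> topspace X. f x \<in> C}"
proof -
  have "{x \<in> topspace X. f x \<in> f ` topspace X - C} = topspace X - {x \<in> topspace X. f x \<in> C}"
    by auto
  then show ?thesis
    unfolding closedin_def topspace_qtop openin_qtop by auto
qed

lemma continuous_map_qtop: "continuous_map X (qtop X f) f"
  unfolding continuous_map_def topspace_qtop openin_qtop by auto

text \<open>The map \<open>h\<close> is induced by \<open>k\<close>: an \<open>h\<close>-preimage
  pulled back along \<open>f\<close> is a \<open>k\<close>-preimage of an open set. This gives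
  continuity of the maps between merge trees.\<close>

lemma continuous_map_between_qtop:
  assumes k: "continuous_map X Y k"
    and h: "\<And>x. x \<in> topspace X \<Longrightarrow> h (f x) = g (k x)"
  shows "continuous_map (qtop X f) (qtop Y g) h"
proof -
  have kY: "k x \<in> topspace Y" if "x \<in> topspace X" for x
    using k that by (auto simp: continuous_map_def)
  have "openin X {x \<in> topspace X. f x \<in> {y \<in> f ` topspace X. h y \<in> U}}"
    if "openin Y {y \<in> topspace Y. g y \<in> U}" for U
  proof -
    have "{x \<in> topspace X. f x \<in> {y \<in> f ` topspace X. h y \<in> U}}
        = {x \<in> topspace X. k x \<in> {y \<in> topspace Y. g y \<in> U}}"
      by (intro Collect_cong conj_cong refl) (simp add: h kY)
    then show ?thesis using openin_continuous_map_preimage[OF k that] by (simp only:)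
  qed
  then show ?thesis
    unfolding continuous_map_def topspace_qtop openin_qtop using h kY by auto
qed

section \<open>The torus, cells and their unions\<close>

lemma topspace_torus_top: "topspace (torus_top L) = range (tproj L)"
  unfolding torus_top_def topspace_qtop by simp

lemma continuous_map_tproj: "continuous_map euclidean (torus_top L) (tproj L)"
  unfolding torus_top_def by (rule continuous_map_qtop)

lemma tproj_eq_iff:
  assumes "add_subgroup L"
  shows "tproj L x = tproj L y \<longleftrightarrow> y - x \<in> L"
proof
  assume "tproj L x = tproj L y"
  moreover have "y \<in> tproj L y"
    using assms by (auto simp: tproj_def add_subgroup_def intro!: exI[of _ 0])
  ultimately have "y \<in> tproj L x" by simp
  then show "y - x \<in> L" by (auto simp: tproj_def)
next
  assume d: "y - x \<in> L"
  have "\<exists>v. x + u = y + v \<and> v \<in> L" if "u \<in> L" for u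
    using add_subgroup_diff[OF assms that d] by (intro exI[of _ "u - (y - x)"]) simp
  moreover have "\<exists>v. y + u = x + v \<and> v \<in> L" if "u \<in> L" for u
    using assms that d unfolding add_subgroup_def by (intro exI[of _ "u + (y - x)"]) simp
  ultimately show "tproj L x = tproj L y" unfolding tproj_def by auto
qed

lemma tproj_add: "add_subgroup L \<Longrightarrow> u \<in> L \<Longrightarrow> tproj L (x + u) = tproj L x"
  by (simp add: tproj_eq_iff add_subgroup_def)

lemma connected_component_translate:
  fixes N :: "'a::real_normed_vector set"
  assumes "connected_component N x y" "\<And>z. z \<in> N \<Longrightarrow> z + w \<in> N"
  shows "connected_component N (x + w) (y + w)"
proof -
  obtain T where "connected T" "T \<subseteq> N" "x \<in> T" "y \<in> T"
    using assms(1) unfolding connected_component_def by blast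
  then show ?thesis
    using assms(2) by (intro connected_componentI[of "(\<lambda>z. z + w) ` T"] connected_continuous_image continuous_intros) auto
qed

text \<open>A cell is a continuous image of the compact convex set
  \<open>cball 0 1 \<inter> S\<close>.\<close>

lemma cell_complex_cellD:
  fixes K :: "'a::euclidean_space set set"
  assumes "cell_complex K" "\<sigma> \<in> K"
  shows "closed \<sigma>" "connected \<sigma>"
proof -
  obtain S :: "'a set" and h h' where S: "subspace S" "homeomorphism (cball 0 1 \<inter> S) \<sigma> h h'"
    using bspec[OF conjunct1[OF assms(1)[unfolded cell_complex_def]] assms(2)] by blast
  have img: "h ` (cball 0 1 \<inter> S) = \<sigma>" and cont: "continuous_on (cball 0 1 \<inter> S) h"
    using S(2) by (auto simp: homeomorphism_def)
  have "compact (cball 0 1 \<inter> S)" using S(1) by (simp add: closed_subspace compact_Int_closed)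
  then show "closed \<sigma>" using compact_continuous_image[OF cont] img compact_imp_closed by metis
  have "convex (cball 0 1 \<inter> S)" using S(1) by (simp add: convex_Int subspace_imp_convex)
  then show "connected \<sigma>" using connected_continuous_image[OF cont] convex_connected img by metis
qed

text \<open>Local finiteness makes arbitrary unions of the closed cells closed.\<close>

lemma cell_complex_closed_Union:
  fixes K :: "'a::euclidean_space set set"
  assumes "cell_complex K" "C \<subseteq> K"
  shows "closed (\<Union>C)"
proof -
  have "locally_finite_in euclidean K"
    unfolding locally_finite_in_def
  proof (intro conjI ballI)
    fix x :: 'a
    obtain e where "e > 0" "finite {\<sigma> \<in> K. \<sigma> \<inter> ball x e \<noteq> {}}"
      using conjunct2[OF conjunct2[OF assms(1)[unfolded cell_complex_def]]] by blast
    then show "\<exists>V. openin euclidean V \<and> x \<in> V \<and> finite {U \<in> K. U \<inter> V \<noteq> {}}"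
      by (intro exI[of _ "ball x e"]) auto
  qed simp
  then have "closedin euclidean (\<Union>C)"
    using assms cell_complex_cellD
    by (intro closedin_locally_finite_Union locally_finite_in_subset[of euclidean K C]) auto
  then show ?thesis by simp
qed

text \<open>\<open>N\<close> is the preimage of the component \<open>\<Gamma>\<close> in Euclidean
  space, so the shadows of \<open>\<Gamma>\<close> are exactly the components of
  \<open>N\<close>.\<close>

locale periodic_sublevel =
  fixes L :: "'a::euclidean_space set" and K F s x\<^sub>0 \<Gamma> N
  assumes lattice: "add_subgroup L"
    and complex: "cell_complex K" "periodic_complex K L" "periodic_filter K L F"
  defines "\<Gamma> \<equiv> connected_component_of_set (subtopology (torus_top L) (tsub K F L s)) x\<^sub>0"
    and "N \<equiv> {y. tproj L y \<in> \<Gamma>}"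
begin

lemma Gamma_subset: "\<Gamma> \<subseteq> range (tproj L) \<inter> tsub K F L s"
  using connected_component_of_subset_topspace[of "subtopology (torus_top L) (tsub K F L s)" x\<^sub>0]
  unfolding \<Gamma>_def topspace_subtopology topspace_torus_top .

lemma tproj_image_preimage: "tproj L ` N = \<Gamma>"
  using Gamma_subset unfolding N_def by auto

lemma preimage_translate: "u \<in> L \<Longrightarrow> y \<in> N \<Longrightarrow> y + u \<in> N"
  unfolding N_def using tproj_add[OF lattice] by simp

text \<open>Some lattice translate of \<open>y\<close> lies in a cell of the sublevel set;
  translating that cell back to \<open>y\<close> preserves its filter value. Its projection is
  connected, stays in the sublevel set and meets \<open>\<Gamma>\<close>, hence lies in
  \<open>\<Gamma>\<close>.\<close>

lemma preimage_cell:
  assumes "y \<in> N"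
  shows "\<exists>\<sigma>\<in>K. y \<in> \<sigma> \<and> \<sigma> \<subseteq> N"
proof -
  have y: "tproj L y \<in> \<Gamma>" using assms by (simp add: N_def)
  then obtain \<sigma> z where \<sigma>: "\<sigma> \<in> K" "F \<sigma> \<le> s" "z \<in> \<sigma>" "tproj L z = tproj L y"
    using Gamma_subset unfolding tsub_def by fastforce
  define u where "u = y - z"
  have u: "u \<in> L" using \<sigma>(4) tproj_eq_iff[OF lattice] u_def by blast
  define \<tau> where "\<tau> = (\<lambda>x. x + u) ` \<sigma>"
  have \<tau>: "\<tau> \<in> K" "F \<tau> \<le> s" "y \<in> \<tau>"
    using complex(2,3) \<sigma> u unfolding \<tau>_def periodic_complex_def periodic_filter_def u_def by auto
  have "tproj L ` \<tau> \<subseteq> tsub K F L s" unfolding tsub_def using \<tau> by blast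
  moreover have "connectedin (torus_top L) (tproj L ` \<tau>)"
    using cell_complex_cellD(2)[OF complex(1) \<tau>(1)]
    by (intro connectedin_continuous_map_image[OF continuous_map_tproj]) simp
  ultimately have "connectedin (subtopology (torus_top L) (tsub K F L s)) (tproj L ` \<tau>)"
    by (simp add: connectedin_subtopology)
  then have "tproj L ` \<tau> \<subseteq> connected_component_of_set (subtopology (torus_top L) (tsub K F L s)) (tproj L y)"
    using \<tau>(3) by (intro connected_component_of_maximal) auto
  also have "\<dots> = \<Gamma>"
    using y connected_component_of_equiv[of _ x\<^sub>0 "tproj L y"] unfolding \<Gamma>_def by auto
  finally show ?thesis using \<tau> unfolding N_def by blast
qed

text \<open>Each point of \<open>A\<close> lies in a cell inside \<open>N\<close>. Cells are
  connected, so this cell stays in \<open>A\<close>, and \<open>A\<close> is a union of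
  cells.\<close>

lemma closed_union_of_components:
  assumes A: "A \<subseteq> N" "\<And>x y. x \<in> A \<Longrightarrow> connected_component N x y \<Longrightarrow> y \<in> A"
  shows "closed A"
proof -
  have "A = \<Union>{\<sigma> \<in> K. \<sigma> \<subseteq> A}"
  proof (intro equalityI subsetI)
    fix x assume x: "x \<in> A"
    then obtain \<sigma> where \<sigma>: "\<sigma> \<in> K" "x \<in> \<sigma>" "\<sigma> \<subseteq> N" using preimage_cell A(1) by blast
    then have "\<sigma> \<subseteq> A"
      using A(2)[OF x] connected_componentI[of \<sigma> N x] cell_complex_cellD(2)[OF complex(1)] by blast
    then show "x \<in> \<Union>{\<sigma> \<in> K. \<sigma> \<subseteq> A}" using \<sigma> by blast
  qed auto
  then show ?thesis using cell_complex_closed_Union[OF complex(1), of "{\<sigma> \<in> K. \<sigma> \<subseteq> A}"] by auto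
qed

text \<open>The lattice acts transitively on the shadows: the orbit of one shadow and its complement in \<open>N\<close>
  are unions of closed cells, so they project to disjoint closed sets covering the connected set \<open>\<Gamma>\<close>.\<close>

lemma components_transitive:
  assumes y: "y \<in> N" and z: "z \<in> N"
  shows "\<exists>w\<in>L. connected_component N (y + w) z"
proof (rule ccontr)
  assume none: "\<not> ?thesis"
  define A where "A = {x. \<exists>w\<in>L. connected_component N (y + w) x}"
  have AN: "A \<subseteq> N" unfolding A_def using connected_component_in by blast
  have cA: "connected_component N x x' \<Longrightarrow> x \<in> A \<longleftrightarrow> x' \<in> A" for x x'
    unfolding A_def using connected_component_trans[of N] connected_component_sym[of N] by blast
  have trA: "x + u \<in> A" if x: "x \<in> A" and u: "u \<in> L" for x u
  proof -
    obtain w where w: "w \<in> L" "connected_component N (y + w) x" using x unfolding A_def by blast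
    then have "connected_component N (y + w + u) (x + u)"
      using preimage_translate[OF u] by (intro connected_component_translate)
    moreover have "w + u \<in> L" using lattice w(1) u by (simp add: add_subgroup_def)
    ultimately show ?thesis unfolding A_def by (auto simp: add.assoc)
  qed
  have trA': "x \<in> A" if "x + u \<in> A" "u \<in> L" for x u
    using trA[OF that(1), of "- u"] lattice that(2) by (simp add: add_subgroup_def)
  \<comment> \<open>A translation invariant set is the full preimage of its projection, so the
    quotient topology sees its projection as closed.\<close>
  have clo: "closedin (torus_top L) (tproj L ` B)"
    if B: "closed B" "\<And>x u. x \<in> B \<Longrightarrow> u \<in> L \<Longrightarrow> x + u \<in> B" for B
  proof -
    have "{x. tproj L x \<in> tproj L ` B} = B"
    proof (intro equalityI subsetI)
      fix x assume "x \<in> {x. tproj L x \<in> tproj L ` B}"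
      then obtain b where "b \<in> B" "tproj L b = tproj L x" by auto
      then show "x \<in> B" using B(2)[of b "x - b"] tproj_eq_iff[OF lattice] by simp
    qed auto
    then show ?thesis unfolding torus_top_def closedin_qtop using B(1) by auto
  qed
  have "closed A" using AN cA by (intro closed_union_of_components) auto
  then have c1: "closedin (torus_top L) (tproj L ` A)" using trA by (intro clo)
  have "closed (N - A)"
    using cA connected_component_in by (intro closed_union_of_components) blast+
  then have c2: "closedin (torus_top L) (tproj L ` (N - A))"
    using preimage_translate trA' by (intro clo) auto
  have "connectedin (torus_top L) \<Gamma>"
    using connectedin_connected_component_of[of "subtopology (torus_top L) (tsub K F L s)" x\<^sub>0]
    unfolding \<Gamma>_def connectedin_subtopology by blast
  moreover have "\<Gamma> \<subseteq> tproj L ` A \<union> tproj L ` (N - A)" using tproj_image_preimage by blast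
  moreover have "tproj L ` A \<inter> tproj L ` (N - A) \<inter> \<Gamma> = {}"
  proof -
    have False if "a \<in> A" "b \<in> N - A" "tproj L a = tproj L b" for a b
      using that trA[of a "b - a"] tproj_eq_iff[OF lattice] by auto
    then show ?thesis by blast
  qed
  moreover have "y \<in> A"
    unfolding A_def using y lattice connected_component_refl[of y N]
    by (auto simp: add_subgroup_def intro!: bexI[of _ 0])
  then have "tproj L ` A \<inter> \<Gamma> \<noteq> {}" using AN tproj_image_preimage by blast
  moreover have "z \<in> N - A" using none z unfolding A_def by blast
  then have "tproj L ` (N - A) \<inter> \<Gamma> \<noteq> {}" using tproj_image_preimage by blast
  ultimately show False
    using c1 c2 unfolding connectedin_closedin by blast
qed

text \<open>The chosen shadow is a translate, by some \<open>w\<close> in \<open>L\<close>, of the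
  component of \<open>y\<close>, and commutativity of translations lets \<open>w\<close> cancel. The
  resulting condition is independent of the choice in \<open>shadow\<close> and monotone in
  \<open>N\<close>.\<close>

lemma period_lattice_eq:
  assumes y: "y \<in> N"
  shows "period_lattice L \<Gamma> = {u \<in> L. connected_component N y (y + u)}"
proof -
  have "components N \<noteq> {}" using y by auto
  then have "shadow L \<Gamma> \<in> components N"
    unfolding shadow_def N_def[symmetric] by (simp add: some_in_eq)
  then obtain z where z: "z \<in> N" "shadow L \<Gamma> = connected_component_set N z"
    by (auto simp: components_def)
  obtain w where w: "w \<in> L" "connected_component N (y + w) z"
    using components_transitive[OF y z(1)] by blast
  have sh: "shadow L \<Gamma> = connected_component_set N (y + w)"
    using connected_component_eq[of z N "y + w"] w(2) z(2) by simp
  have untranslate: "connected_component N x x'" if "connected_component N (x + v) (x' + v)" "v \<in> L" for x x' v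
  proof -
    have "- v \<in> L" using lattice that(2) by (simp add: add_subgroup_def)
    then have "connected_component N (x + v + - v) (x' + v + - v)"
      using connected_component_translate[OF that(1) preimage_translate] by blast
    then show ?thesis by simp
  qed
  have "(\<lambda>x. x + u) ` shadow L \<Gamma> = shadow L \<Gamma> \<longleftrightarrow> connected_component N y (y + u)" if u: "u \<in> L" for u
  proof -
    have "(\<lambda>x. x + u) ` connected_component_set N (y + w) = connected_component_set N (y + w + u)"
    proof (intro equalityI subsetI)
      fix x assume "x \<in> connected_component_set N (y + w + u)"
      then have "connected_component N (y + w + u) (x - u + u)" by simp
      then have "connected_component N (y + w) (x - u)" using u by (rule untranslate)
      then show "x \<in> (\<lambda>x. x + u) ` connected_component_set N (y + w)"
        by (intro image_eqI[of _ _ "x - u"]) auto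
    qed (auto intro: connected_component_translate preimage_translate[OF u])
    then have "(\<lambda>x. x + u) ` shadow L \<Gamma> = shadow L \<Gamma>
        \<longleftrightarrow> connected_component_set N (y + w + u) = connected_component_set N (y + w)"
      unfolding sh by simp
    also have "\<dots> \<longleftrightarrow> connected_component N (y + w) (y + w + u)"
      using preimage_translate[OF w(1) y] preimage_translate[OF u] connected_component_sym
      unfolding connected_component_eq_eq by blast
    also have "\<dots> \<longleftrightarrow> connected_component N (y + w) (y + u + w)" by (simp add: algebra_simps)
    also have "\<dots> \<longleftrightarrow> connected_component N y (y + u)"
      using untranslate[OF _ w(1)] connected_component_translate[of N y "y + u" w] preimage_translate[OF w(1)] by blast
    finally show ?thesis .
  qed
  then show ?thesis unfolding period_lattice_def by blast
qed

lemma add_subgroup_period_lattice: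
  assumes y: "y \<in> N"
  shows "add_subgroup (period_lattice L \<Gamma>)"
  unfolding add_subgroup_def period_lattice_eq[OF y]
proof (intro conjI ballI)
  show "0 \<in> {u \<in> L. connected_component N y (y + u)}"
    using lattice y connected_component_refl[of y N] by (simp add: add_subgroup_def)
next
  fix u v assume u: "u \<in> {u \<in> L. connected_component N y (y + u)}"
    and v: "v \<in> {u \<in> L. connected_component N y (y + u)}"
  have "connected_component N (y + v) (y + u + v)"
    using u v preimage_translate by (intro connected_component_translate) auto
  then have "connected_component N y (y + u + v)"
    using v connected_component_trans by blast
  then show "u + v \<in> {u \<in> L. connected_component N y (y + u)}"
    using u v lattice by (simp add: add_subgroup_def add.assoc)
next
  fix u assume u: "u \<in> {u \<in> L. connected_component N y (y + u)}"
  then have mL: "- u \<in> L" using lattice by (simp add: add_subgroup_def)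
  have "connected_component N (y + - u) (y + u + - u)"
    using u preimage_translate[OF mL] by (intro connected_component_translate) auto
  then show "- u \<in> {u \<in> L. connected_component N y (y + u)}"
    using mL connected_component_sym by force
qed

end

lemma mono_le_shadow_monomial:
  fixes L :: "'a::euclidean_space set"
  assumes L: "is_lattice L" and K: "cell_complex K" "periodic_complex K L"
    and F: "periodic_filter K L F" and G: "periodic_filter K L G"
    and sub: "tsub K F L s \<subseteq> tsub K G L t"
    and x: "x \<in> topspace (subtopology (torus_top L) (tsub K F L s))"
  shows "mono_le (shadow_monomial L (connected_component_of_set (subtopology (torus_top L) (tsub K G L t)) x))
                 (shadow_monomial L (connected_component_of_set (subtopology (torus_top L) (tsub K F L s)) x))"
proof -
  define A where "A = connected_component_of_set (subtopology (torus_top L) (tsub K F L s)) x"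
  define B where "B = connected_component_of_set (subtopology (torus_top L) (tsub K G L t)) x"
  note sg = add_subgroup_lattice[OF L]
  interpret F: periodic_sublevel L K F s x A "{y. tproj L y \<in> A}"
    using sg K F unfolding A_def by unfold_locales
  interpret G: periodic_sublevel L K G t x B "{y. tproj L y \<in> B}"
    using sg K G unfolding B_def by unfold_locales
  have AB: "A \<subseteq> B"
    unfolding A_def B_def using connected_component_of_mono[OF _ sub] by blast
  obtain y where y: "x = tproj L y" using x by (auto simp: topspace_torus_top)
  have "x \<in> A" using x connected_component_of_refl unfolding A_def by fastforce
  then have yA: "y \<in> {y. tproj L y \<in> A}" and yB: "y \<in> {y. tproj L y \<in> B}" using y AB by auto
  define P where "P = period_lattice L A"
  define Q where "Q = period_lattice L B"
  \<comment> \<open>With the common base point \<open>y\<close>, points connected in the smaller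
    preimage stay connected in the larger one.\<close>
  have PQ: "P \<subseteq> Q"
    unfolding P_def Q_def F.period_lattice_eq[OF yA] G.period_lattice_eq[OF yB]
    using AB connected_component_of_subset[of "{y. tproj L y \<in> A}" _ _ "{y. tproj L y \<in> B}"] by blast
  have lat: "is_lattice P" "is_lattice Q"
    using F.add_subgroup_period_lattice[OF yA] G.add_subgroup_period_lattice[OF yB]
    unfolding P_def Q_def
    by (auto intro!: is_lattice_subgroup[OF L] simp: period_lattice_def)
  \<comment> \<open>The bound by the ambient dimension keeps the natural number subtraction in the
    exponent from truncating, so a strictly larger dimension gives a strictly smaller
    exponent.\<close>
  have le: "lattice_dim P \<le> lattice_dim Q" "lattice_dim Q \<le> DIM('a)"
    unfolding lattice_dim_def using PQ by (auto intro: dim_subset dim_subset_UNIV)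
  have pos: "0 \<le> lattice_vol L" by (simp add: lattice_vol_def pvol_def Let_def)
  have "mono_le (shadow_monomial L B) (shadow_monomial L A)"
  proof (cases "lattice_dim P = lattice_dim Q")
    case True
    have "lattice_vol Q \<le> lattice_vol P" using lattice_vol_antimono[OF lat PQ True] .
    then show ?thesis
      using True pos unfolding mono_le_def shadow_monomial_def Let_def P_def[symmetric] Q_def[symmetric]
      by (auto intro!: mult_right_mono divide_right_mono)
  next
    case False
    then show ?thesis
      using le unfolding mono_le_def shadow_monomial_def Let_def P_def[symmetric] Q_def[symmetric] by auto
  qed
  then show ?thesis unfolding A_def B_def .
qed

section \<open>The interleaving\<close>

text \<open>Sends a component to the one containing it \<open>\<epsilon>\<close> higher in the other
  filtration. The union over all points of \<open>A\<close> avoids choosing a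
  representative.\<close>

definition merge_shift :: "'b topology \<Rightarrow> (real \<Rightarrow> 'b set) \<Rightarrow> real \<Rightarrow> 'b set \<times> real \<Rightarrow> 'b set \<times> real" where
  "merge_shift T Sub \<epsilon> = (\<lambda>(A, s).
     (\<Union>x\<in>A. connected_component_of_set (subtopology T (Sub (s + \<epsilon>))) x, s + \<epsilon>))"

text \<open>All terms of the union agree, since points connected in \<open>Sub s\<close> stay
  connected in the larger \<open>Sub' (s + \<epsilon>)\<close>, and the index set contains
  \<open>x\<close>.\<close>

lemma merge_shift_mt_pt:
  assumes "x \<in> topspace T" "x \<in> Sub s" "Sub s \<subseteq> Sub' (s + \<epsilon>)"
  shows "merge_shift T Sub' \<epsilon> (mt_pt T Sub (x, s)) = mt_pt T Sub' (x, s + \<epsilon>)"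
proof -
  have refl: "connected_component_of (subtopology T (Sub s)) x x"
    using assms by (simp add: connected_component_of_refl)
  have eq: "connected_component_of_set (subtopology T (Sub' (s + \<epsilon>))) y =
      connected_component_of_set (subtopology T (Sub' (s + \<epsilon>))) x"
    if "connected_component_of (subtopology T (Sub s)) x y" for y
    using connected_component_of_mono[OF that assms(3)] connected_component_of_equiv by metis
  have "(\<Union>y\<in>connected_component_of_set (subtopology T (Sub s)) x.
      connected_component_of_set (subtopology T (Sub' (s + \<epsilon>))) y) =
      connected_component_of_set (subtopology T (Sub' (s + \<epsilon>))) x"
  proof (rule SUP_eq_const)
    show "connected_component_of_set (subtopology T (Sub s)) x \<noteq> {}" using refl by blast
  qed (simp add: eq)
  then show ?thesis by (simp add: merge_shift_def mt_pt_def)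
qed

lemma topspace_mt_top:
  "topspace (mt_top T Sub) = mt_pt T Sub ` {(x, s). x \<in> topspace T \<and> x \<in> Sub s}"
  unfolding mt_top_def topspace_qtop by (intro arg_cong[where f = "image _"]) auto

lemma continuous_map_merge_shift:
  assumes "\<And>s. Sub s \<subseteq> Sub' (s + \<epsilon>)"
  shows "continuous_map (mt_top T Sub) (mt_top T Sub') (merge_shift T Sub' \<epsilon>)"
  unfolding mt_top_def
\<comment> \<open>On representatives the shift fixes the point and raises only the height, which is
  continuous before passing to quotients.\<close>
proof (rule continuous_map_between_qtop[where k = "\<lambda>(x, s). (x, s + \<epsilon>)"])
  have "continuous_map (prod_topology T euclideanreal) (prod_topology T euclideanreal)
      (\<lambda>z. (fst z, snd z + \<epsilon>))"
    by (intro continuous_map_pairedI continuous_map_fst continuous_map_add continuous_map_snd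
        continuous_map_const[THEN iffD2]) simp
  then show "continuous_map (subtopology (prod_topology T euclideanreal) {(x, s). x \<in> Sub s})
     (subtopology (prod_topology T euclideanreal) {(x, s). x \<in> Sub' s}) (\<lambda>(x, s). (x, s + \<epsilon>))"
    by (auto simp: continuous_map_in_subtopology case_prod_unfold intro: continuous_map_from_subtopology
        dest: subsetD[OF assms])
  show "merge_shift T Sub' \<epsilon> (mt_pt T Sub z) = mt_pt T Sub' (case z of (x, s) \<Rightarrow> (x, s + \<epsilon>))"
    if "z \<in> topspace (subtopology (prod_topology T euclideanreal) {(x, s). x \<in> Sub s})" for z
    using that merge_shift_mt_pt[of _ T Sub _ Sub' \<epsilon>] assms by auto
qed

lemma tsub_subset_tsub:
  assumes "\<And>\<sigma>. \<sigma> \<in> K \<Longrightarrow> G \<sigma> \<le> F \<sigma> + \<epsilon>"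
  shows "tsub K F L s \<subseteq> tsub K G L (s + \<epsilon>)"
proof -
  have "G \<sigma> \<le> s + \<epsilon>" if "\<sigma> \<in> K" "F \<sigma> \<le> s" for \<sigma>
    using assms[OF that(1)] that(2) by linarith
  then show ?thesis unfolding tsub_def by blast
qed

text \<open>Both maps are evaluated on one representative \<open>(x, s)\<close>. This is one half of
  compatibility; exchanging \<open>F\<close> and \<open>G\<close> yields the other.\<close>

lemma merge_shift_pmt:
  fixes L :: "'a::euclidean_space set"
  assumes L: "is_lattice L" and K: "cell_complex K" "periodic_complex K L"
    and F: "periodic_filter K L F" and G: "periodic_filter K L G"
    and FG: "\<And>\<sigma>. \<sigma> \<in> K \<Longrightarrow> \<bar>F \<sigma> - G \<sigma>\<bar> \<le> \<epsilon>"
    and \<Gamma>: "\<Gamma> \<in> topspace (mtop (pmt K F L))"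
  defines "\<phi> \<equiv> merge_shift (torus_top L) (tsub K G L) \<epsilon>"
    and "\<psi> \<equiv> merge_shift (torus_top L) (tsub K F L) \<epsilon>"
  shows "hgt (pmt K G L) (\<phi> \<Gamma>) = hgt (pmt K F L) \<Gamma> + \<epsilon>"
    and "covers (pmt K F L) (\<psi> (\<phi> \<Gamma>)) \<Gamma>"
    and "mono_le (frq (pmt K G L) (\<phi> \<Gamma>)) (frq (pmt K F L) \<Gamma>)"
proof -
  obtain x s where x: "x \<in> topspace (torus_top L)" "x \<in> tsub K F L s"
      and \<Gamma>_eq: "\<Gamma> = mt_pt (torus_top L) (tsub K F L) (x, s)"
    using \<Gamma> by (auto simp: pmt_def topspace_mt_top)
  have le: "G \<sigma> \<le> F \<sigma> + \<epsilon>" "F \<sigma> \<le> G \<sigma> + \<epsilon>" if "\<sigma> \<in> K" for \<sigma>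
    using FG[OF that] by linarith+
  have FG': "tsub K F L s \<subseteq> tsub K G L (s + \<epsilon>)" for s
    by (rule tsub_subset_tsub[OF le(1)])
  have GF: "tsub K G L s \<subseteq> tsub K F L (s + \<epsilon>)" for s
    by (rule tsub_subset_tsub[OF le(2)])
  have \<phi>: "\<phi> \<Gamma> = mt_pt (torus_top L) (tsub K G L) (x, s + \<epsilon>)"
    unfolding \<phi>_def \<Gamma>_eq using x FG' by (rule merge_shift_mt_pt)
  have "x \<in> tsub K G L (s + \<epsilon>)" using x(2) FG' by blast
  then have \<psi>: "\<psi> (\<phi> \<Gamma>) = mt_pt (torus_top L) (tsub K F L) (x, s + \<epsilon> + \<epsilon>)"
    unfolding \<psi>_def \<phi> using x(1) GF by (intro merge_shift_mt_pt)
  show "hgt (pmt K G L) (\<phi> \<Gamma>) = hgt (pmt K F L) \<Gamma> + \<epsilon>"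
    unfolding \<phi> unfolding \<Gamma>_eq by (simp add: pmt_def mt_pt_def)
  show "mono_le (frq (pmt K G L) (\<phi> \<Gamma>)) (frq (pmt K F L) \<Gamma>)"
    unfolding \<phi> unfolding \<Gamma>_eq using mono_le_shadow_monomial[OF L K F G FG'] x by (simp add: pmt_def mt_pt_def)
  \<comment> \<open>The point \<open>x\<close> lies in the projection of some cell, and the bound at
    this cell forces \<open>\<epsilon>\<close> to be nonnegative, as the height condition of
    \<open>covers\<close> requires.\<close>
  have "F \<sigma> \<le> s \<Longrightarrow> \<sigma> \<in> K \<Longrightarrow> 0 \<le> \<epsilon>" for \<sigma> using FG[of \<sigma>] by linarith
  then have "0 \<le> \<epsilon>" using x(2) unfolding tsub_def by blast
  moreover have "tsub K F L s \<subseteq> tsub K F L (s + \<epsilon> + \<epsilon>)" using FG' GF by blast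
  ultimately show "covers (pmt K F L) (\<psi> (\<phi> \<Gamma>)) \<Gamma>"
    unfolding covers_def \<psi> unfolding \<Gamma>_eq
    by (auto simp: pmt_def mt_pt_def intro: connected_component_of_mono)
qed

lemma compatible_merge_shift:
  fixes L :: "'a::euclidean_space set"
  assumes L: "is_lattice L" and K: "cell_complex K" "periodic_complex K L"
    and F: "periodic_filter K L F" and G: "periodic_filter K L G"
    and FG: "\<And>\<sigma>. \<sigma> \<in> K \<Longrightarrow> \<bar>F \<sigma> - G \<sigma>\<bar> \<le> \<epsilon>"
  shows "compatible \<epsilon> (pmt K F L) (pmt K G L)
     (merge_shift (torus_top L) (tsub K G L) \<epsilon>) (merge_shift (torus_top L) (tsub K F L) \<epsilon>)"
proof -
  have GF: "\<bar>G \<sigma> - F \<sigma>\<bar> \<le> \<epsilon>" if "\<sigma> \<in> K" for \<sigma> using FG[OF that] by linarith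
  have "G \<sigma> \<le> F \<sigma> + \<epsilon>" "F \<sigma> \<le> G \<sigma> + \<epsilon>" if "\<sigma> \<in> K" for \<sigma> using FG[OF that] by linarith+
  then have "continuous_map (mtop (pmt K F L)) (mtop (pmt K G L)) (merge_shift (torus_top L) (tsub K G L) \<epsilon>)"
    "continuous_map (mtop (pmt K G L)) (mtop (pmt K F L)) (merge_shift (torus_top L) (tsub K F L) \<epsilon>)"
    by (simp_all add: pmt_def continuous_map_merge_shift tsub_subset_tsub)
  then show ?thesis
    unfolding compatible_def
    using merge_shift_pmt[OF L K F G FG] merge_shift_pmt[OF L K G F GF] by blast
qed

section \<open>Reflexivity of splintering and the passage to J\<close>

lemma dI_refl: "dI M M = 0"
proof -
  have "compatible 0 M M id id"
    unfolding compatible_def covers_def mono_le_def by simp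
  then have "(0::ereal) \<in> {ereal \<epsilon> | \<epsilon>. \<epsilon> \<ge> 0 \<and> (\<exists>\<phi> \<psi>. compatible \<epsilon> M M \<phi> \<psi>)}"
    by (auto simp: zero_ereal_def)
  then have "dI M M \<le> 0" unfolding dI_def by (rule Inf_lower)
  moreover have "0 \<le> dI M M" unfolding dI_def by (rule Inf_greatest) auto
  ultimately show ?thesis by simp
qed

text \<open>The identity has singleton fibres, so frequencies are divided by 1 and the subtrees
  compared are equal.\<close>

lemma splinters_refl: "splinters M M"
proof -
  have "{A \<in> topspace (mtop M). id A = \<Gamma>} = {\<Gamma>}" if "\<Gamma> \<in> topspace (mtop M)" for \<Gamma>
    using that by auto
  then show ?thesis
    unfolding splinters_def by (intro exI[of _ id]) (simp add: dI_refl)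
qed

text \<open>The sequence of length one consisting of \<open>M\<close> and \<open>M'\<close> is
  admissible in the infimum.\<close>

lemma J_dist_le_dI:
  assumes "M \<in> pmtrees" "M' \<in> pmtrees"
  shows "J_dist M M' \<le> dI M M'"
proof -
  have equiv: "pmt_equiv N N" if "N \<in> pmtrees" for N :: "'a pmtree"
    using that splinters_refl unfolding pmt_equiv_def by blast
  show ?thesis
    unfolding J_dist_def
    by (rule Inf_lower, intro CollectI exI[of _ 1] exI[of _ "\<lambda>_. M"] exI[of _ "\<lambda>_. M'"])
      (simp add: assms equiv)
qed

theorem mainTheorem3:
  fixes L :: "'a::euclidean_space set" and K :: "'a set set" and F G :: "'a set \<Rightarrow> real"
  assumes "is_lattice L" and "lattice_dim L = DIM('a)"
    and "cell_complex K" and "periodic_complex K L"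
    and "periodic_filter K L F" and "periodic_filter K L G"
  shows "dI (pmt K F L) (pmt K G L) \<le> sup_dist K F G \<and>
         J_dist (pmt K F L) (pmt K G L) \<le> sup_dist K F G"
proof -
  have dI: "dI (pmt K F L) (pmt K G L) \<le> sup_dist K F G"
  \<comment> \<open>In the finite case the supremum itself serves as \<open>\<epsilon>\<close>,
    without a limiting argument. An infinite bound is trivial, and the inserted 0 rules out the
    value minus infinity, also for empty \<open>K\<close>.\<close>
  proof (cases "sup_dist K F G")
    case (real \<epsilon>)
    have upper: "e \<le> sup_dist K F G" if "e \<in> insert 0 ((\<lambda>\<sigma>. ereal \<bar>F \<sigma> - G \<sigma>\<bar>) ` K)" for e
      unfolding sup_dist_def using that by (rule Sup_upper)
    have "0 \<le> \<epsilon>" using upper[of 0] real by simp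
    moreover have "\<bar>F \<sigma> - G \<sigma>\<bar> \<le> \<epsilon>" if "\<sigma> \<in> K" for \<sigma>
      using upper[of "ereal \<bar>F \<sigma> - G \<sigma>\<bar>"] that real by simp
    then have "\<exists>\<phi> \<psi>. compatible \<epsilon> (pmt K F L) (pmt K G L) \<phi> \<psi>"
      using compatible_merge_shift[OF assms(1,3-6)] by blast
    ultimately have "dI (pmt K F L) (pmt K G L) \<le> ereal \<epsilon>"
      unfolding dI_def by (intro Inf_lower) blast
    then show ?thesis using real by simp
  next
    case MInf
    have "0 \<le> sup_dist K F G" unfolding sup_dist_def by (rule Sup_upper) simp
    then show ?thesis using MInf by simp
  qed simp
  have "pmt K F L \<in> pmtrees" "pmt K G L \<in> pmtrees"
    using assms unfolding pmtrees_def admissible_def by blast+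
  then show ?thesis using dI J_dist_le_dI order_trans by blast
qed

end
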